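(* Let $G$ be a finite group and $p$ a prime. Then $$U_\circ(R_F(G))=\{\pm\chi|_{\mathscr E_p(G)}:\chi\in\hat G\}.$$
   Context: Let $K=\bar{\mathbb Q}_p$ be an algebraic closure of the $p$-adic numbers, $\mathcal O$ the integral closure of $\mathbb Z_p$ in $K$, $\mathfrak p$ its unique maximal ideal and $F=\mathcal O/\mathfrak p$, an algebraically closed field of characteristic $p$. (For a fixed $G$ one may equivalently use a $p$-modular system large enough for $G$.) $\mathscr E_p(G)$ is the set of $p$-regular elements of $G$ (elements of order prime to $p$). $R_F(G)$ is the Brauer character ring of $G$: the Grothendieck ring of finitely generated $FG$-modules with respect to short exact sequences, identified with the ring of virtual Brauer characters, i.e. functions $\mathscr E_p(G)\to\mathcal O$ that are $\mathbb Z$-linear combinations of Brauer characters of $FG$-modules. The duality operator $-^\circ$ on $R_F(G)$ is the ring automorphism induced by $[M]\mapsto[M^\circ]$, $M^\circ=\mathrm{Hom}_F(M,F)$. The group of orthogonal units is $U_\circ(R_F(G))=\{a\in R_F(G)^\times: a^{-1}=a^\circ\}$. $\hat G$ is the group of linear characters of $G$, i.e. homomorphisms $\chi:G\to\mathcal O^\times$; $\chi|_{\mathscr E_p(G)}$ is the restriction of $\chi$ to $p$-regular elements. *)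

theory Defs
  imports
    "HOL-Algebra.Algebraic_Closure_Type"
    "HOL-Algebra.Multiplicative_Group"
    "HOL-Algebra.QuotRing"
    "Jordan_Normal_Form.Char_Poly"
begin

section \<open>The fields\<close>

text \<open>The ring of \<open>p\<close>-adic integers as the inverse limit of the rings \<open>\<int>/p\<^sup>n\<close>: a compatible
  system of residues is represented by its least non-negative representatives.\<close>

definition padic_ints :: "nat \<Rightarrow> (nat \<Rightarrow> int) ring" where
  "padic_ints p =
     \<lparr> carrier = {f. \<forall>n. 0 \<le> f n \<and> f n < int p ^ n \<and> f (Suc n) mod int p ^ n = f n},
       monoid.mult = (\<lambda>f g n. (f n * g n) mod int p ^ n),
       one = (\<lambda>n. 1 mod int p ^ n),
       zero = (\<lambda>n. 0),
       add = (\<lambda>f g n. (f n + g n) mod int p ^ n) \<rparr>"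

text \<open>In the following, \<open>\<iota>\<close> embeds the \<open>p\<close>-adic integers into a field. The \<open>p\<close>-adic numbers are
  then the fraction field of the image of \<open>\<iota>\<close>.\<close>

definition padic_nums :: "nat \<Rightarrow> ((nat \<Rightarrow> int) \<Rightarrow> 'k::field) \<Rightarrow> 'k set" where
  "padic_nums p \<iota> =
     {\<iota> a / \<iota> b | a b. a \<in> carrier (padic_ints p) \<and> b \<in> carrier (padic_ints p)
                      \<and> b \<noteq> \<zero>\<^bsub>padic_ints p\<^esub>}"

text \<open>The field \<open>'k\<close> is an algebraic closure of the \<open>p\<close>-adic numbers: it is algebraically closed
  by its type class, and algebraic over the subfield of \<open>p\<close>-adic numbers.\<close>

definition padic_alg_closure :: "nat \<Rightarrow> ((nat \<Rightarrow> int) \<Rightarrow> 'k::alg_closed_field) \<Rightarrow> bool" where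
  "padic_alg_closure p \<iota> \<longleftrightarrow>
     \<iota> \<in> Ring.ring_hom (padic_ints p) ring_of_type_algebra \<and>
     inj_on \<iota> (carrier (padic_ints p)) \<and>
     (\<forall>x. \<exists>f. f \<noteq> 0 \<and> range (poly.coeff f) \<subseteq> padic_nums p \<iota> \<and> poly f x = 0)"

text \<open>The integral closure \<open>\<O>\<close> of the \<open>p\<close>-adic integers in \<open>'k\<close> and its unique maximal ideal.\<close>

definition integral_closure :: "nat \<Rightarrow> ((nat \<Rightarrow> int) \<Rightarrow> 'k::field) \<Rightarrow> 'k ring" where
  "integral_closure p \<iota> = ring_of_type_algebra
     \<lparr> carrier := {x. \<exists>f. lead_coeff f = 1 \<and> range (poly.coeff f) \<subseteq> \<iota> ` carrier (padic_ints p)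
                        \<and> poly f x = 0} \<rparr>"

definition max_ideal :: "nat \<Rightarrow> ((nat \<Rightarrow> int) \<Rightarrow> 'k::field) \<Rightarrow> 'k set" where
  "max_ideal p \<iota> = (THE I. maximalideal I (integral_closure p \<iota>))"

text \<open>The field \<open>'f\<close> is the residue field of \<open>\<O>\<close>, with \<open>red\<close> as the canonical projection.\<close>

definition residue_map ::
    "nat \<Rightarrow> ((nat \<Rightarrow> int) \<Rightarrow> 'k::field) \<Rightarrow> ('k \<Rightarrow> 'f::field) \<Rightarrow> bool" where
  "residue_map p \<iota> red \<longleftrightarrow>
     red \<in> Ring.ring_hom (integral_closure p \<iota>) ring_of_type_algebra \<and>
     red ` carrier (integral_closure p \<iota>) = UNIV \<and>
     a_kernel (integral_closure p \<iota>) ring_of_type_algebra red = max_ideal p \<iota>"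


section \<open>Brauer characters\<close>

definition p_regular :: "nat \<Rightarrow> ('g, 'b) monoid_scheme \<Rightarrow> 'g set" where
  "p_regular p G = {g \<in> carrier G. coprime p (group.ord G g)}"

text \<open>A finitely generated \<open>FG\<close>-module is finite-dimensional over \<open>F\<close>; it is given, after the
  choice of a basis, by a matrix representation. The matrices of the dual module
  \<open>Hom\<^sub>F(M, F)\<close> with respect to the dual basis are those of \<open>dual_rep\<close>.\<close>

definition mat_rep :: "('g, 'b) monoid_scheme \<Rightarrow> nat \<Rightarrow> ('g \<Rightarrow> 'f::field mat) \<Rightarrow> bool" where
  "mat_rep G n \<rho> \<longleftrightarrow>
     (\<forall>g\<in>carrier G. \<rho> g \<in> carrier_mat n n) \<and>
     (\<forall>g\<in>carrier G. \<forall>h\<in>carrier G. \<rho> (g \<otimes>\<^bsub>G\<^esub> h) = \<rho> g * \<rho> h) \<and>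
     \<rho> \<one>\<^bsub>G\<^esub> = 1\<^sub>m n"

definition dual_rep :: "('g, 'b) monoid_scheme \<Rightarrow> ('g \<Rightarrow> 'f::field mat) \<Rightarrow> 'g \<Rightarrow> 'f mat" where
  "dual_rep G \<rho> g = transpose_mat (\<rho> (inv\<^bsub>G\<^esub> g))"

text \<open>The lift of a root of unity of \<open>F\<close> to the root of unity of \<open>\<O>\<close> of order prime to \<open>p\<close>.\<close>

definition teich ::
    "nat \<Rightarrow> ((nat \<Rightarrow> int) \<Rightarrow> 'k::field) \<Rightarrow> ('k \<Rightarrow> 'f::field) \<Rightarrow> 'f \<Rightarrow> 'k" where
  "teich p \<iota> red x =
     (THE \<zeta>. \<zeta> \<in> carrier (integral_closure p \<iota>) \<and> red \<zeta> = x \<and>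
             (\<exists>m>0. coprime p m \<and> \<zeta> ^ m = 1))"

text \<open>Functions on the \<open>p\<close>-regular elements are extensional, i.e.\ \<open>undefined\<close> elsewhere.
  The roots of the characteristic polynomial are taken with multiplicity.\<close>

definition brauer_char ::
    "nat \<Rightarrow> ((nat \<Rightarrow> int) \<Rightarrow> 'k::field) \<Rightarrow> ('k \<Rightarrow> 'f::field) \<Rightarrow> ('g, 'b) monoid_scheme \<Rightarrow>
     ('g \<Rightarrow> 'f mat) \<Rightarrow> 'g \<Rightarrow> 'k" where
  "brauer_char p \<iota> red G \<rho> =
     (\<lambda>g\<in>p_regular p G. \<Sum>x\<in>#proots (char_poly (\<rho> g)). teich p \<iota> red x)"

text \<open>The ring \<open>R\<^sub>F(G)\<close> of virtual Brauer characters with pointwise operations.\<close>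

definition brauer_ring ::
    "nat \<Rightarrow> ((nat \<Rightarrow> int) \<Rightarrow> 'k::field) \<Rightarrow> ('k \<Rightarrow> 'f::field) \<Rightarrow> ('g, 'b) monoid_scheme \<Rightarrow>
     ('g \<Rightarrow> 'k) ring" where
  "brauer_ring p \<iota> red G =
     \<lparr> carrier = {\<lambda>g\<in>p_regular p G. \<Sum>i<k. of_int (c i) * brauer_char p \<iota> red G (\<rho> i) g
                  | (k::nat) (c :: nat \<Rightarrow> int) \<rho>. \<forall>i<k. \<exists>n. mat_rep G n (\<rho> i)},
       monoid.mult = (\<lambda>a b. \<lambda>g\<in>p_regular p G. a g * b g),
       one = (\<lambda>g\<in>p_regular p G. 1),
       zero = (\<lambda>g\<in>p_regular p G. 0),
       add = (\<lambda>a b. \<lambda>g\<in>p_regular p G. a g + b g) \<rparr>"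

text \<open>The duality operator, i.e.\ the ring automorphism induced by \<open>[M] \<mapsto> [M\<degree>]\<close>.\<close>

definition duality ::
    "nat \<Rightarrow> ((nat \<Rightarrow> int) \<Rightarrow> 'k::field) \<Rightarrow> ('k \<Rightarrow> 'f::field) \<Rightarrow> ('g, 'b) monoid_scheme \<Rightarrow>
     ('g \<Rightarrow> 'k) \<Rightarrow> 'g \<Rightarrow> 'k" where
  "duality p \<iota> red G =
     (THE D. D \<in> ring_iso (brauer_ring p \<iota> red G) (brauer_ring p \<iota> red G) \<and>
             D \<in> extensional (carrier (brauer_ring p \<iota> red G)) \<and>
             (\<forall>n \<rho>. mat_rep G n \<rho> \<longrightarrow>
                D (brauer_char p \<iota> red G \<rho>) = brauer_char p \<iota> red G (dual_rep G \<rho>)))"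

definition orthogonal_units ::
    "nat \<Rightarrow> ((nat \<Rightarrow> int) \<Rightarrow> 'k::field) \<Rightarrow> ('k \<Rightarrow> 'f::field) \<Rightarrow> ('g, 'b) monoid_scheme \<Rightarrow>
     ('g \<Rightarrow> 'k) set" where
  "orthogonal_units p \<iota> red G =
     {a \<in> Units (brauer_ring p \<iota> red G).
        inv\<^bsub>brauer_ring p \<iota> red G\<^esub> a = duality p \<iota> red G a}"

definition linear_chars ::
    "nat \<Rightarrow> ((nat \<Rightarrow> int) \<Rightarrow> 'k::field) \<Rightarrow> ('g, 'b) monoid_scheme \<Rightarrow> ('g \<Rightarrow> 'k) set" where
  "linear_chars p \<iota> G = hom G (units_of (integral_closure p \<iota>))"

end

theory Submission
  imports Defs "Jordan_Normal_Form.Schur_Decomposition" "Jordan_Normal_Form.DL_Rank"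
begin

text \<open>Let \<open>a\<close> be an orthogonal unit. Duality is \<open>a \<mapsto> (g \<mapsto> a(g\<inverse>))\<close>, so the condition says
\<open>a(g) a(g\<inverse>) = 1\<close> for every \<open>p\<close>-regular \<open>g\<close>. Restricted to the cyclic group generated by such a \<open>g\<close>,
of order \<open>u\<close> say, a virtual Brauer character is \<open>g\<^sup>j \<mapsto> \<Sum>\<^sub>\<zeta> n\<^sub>\<zeta> \<zeta>\<^sup>j\<close> with integers \<open>n\<^sub>\<zeta>\<close>, where \<open>\<zeta>\<close> runs
over the \<open>u\<close>-th roots of unity. Averaging \<open>a(g\<^sup>j) a(g\<^sup>-\<^sup>j) = 1\<close> over \<open>j\<close> gives \<open>\<Sum>\<^sub>\<zeta> n\<^sub>\<zeta>\<^sup>2 = 1\<close>, and hence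
\<open>a(g) = \<plusminus>\<zeta>\<close> for a single \<open>\<zeta>\<close>, where the sign is \<open>a(1)\<close>. It remains to see that these roots of unity
fit together to a homomorphism on all of \<open>G\<close>.

This is what determinants do. If \<open>a = \<Sum>\<^sub>i c\<^sub>i \<phi>\<^sub>i\<close> with \<open>\<phi>\<^sub>i\<close> the Brauer character of \<open>\<rho>\<^sub>i\<close>, then
\<open>\<delta> = \<Prod>\<^sub>i det(\<rho>\<^sub>i)\<^bsup>c\<^sub>i\<^esup>\<close> is a homomorphism from \<open>G\<close> to the units of the residue field, and on a
\<open>p\<close>-regular \<open>g\<close> it is \<open>\<Prod>\<^sub>\<zeta> red(\<zeta>)\<^bsup>n\<^sub>\<zeta>\<^esup>\<close> with the same integers \<open>n\<^sub>\<zeta>\<close> as above (\<open>ex_virtual_det\<close>). So if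
\<open>a(1) = 1\<close>, then \<open>\<delta>(g) = red(a(g))\<close>, and \<open>a\<close> is the restriction of the Teichmueller lift of \<open>\<delta>\<close>, which is a
linear character. If \<open>a(1) = -1\<close>, the same applies to \<open>-a\<close>. Conversely, a linear character restricts to
the Brauer character of its own reduction, and \<open>\<chi>(g) \<chi>(g\<inverse>) = 1\<close>.

The remaining work is to give these notions their expected properties. The residue field has
characteristic \<open>p\<close> because \<open>1/p\<close> cannot be the residue of an integral element (\<open>of_nat_p_eq_0\<close>); hence
reduction is a bijection on \<open>m\<close>-th roots of unity for \<open>m\<close> prime to \<open>p\<close>
(\<open>roots_of_unity_residue_field\<close>). The characteristic polynomial of a matrix of order \<open>m\<close> divides a power
of \<open>X\<^sup>m - 1\<close>, so it splits and the matrix can be brought into triangular form; the eigenvalues of powers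
and Kronecker products and the determinant are then read off the diagonal. Kronecker products show that the
virtual Brauer characters form a ring, which is needed to identify the duality operator
(\<open>duality_eq\<close>).\<close>

section \<open>Triangular form and characteristic polynomials over a field\<close>

text \<open>Induction on the size: an eigenvector is completed to a basis, and the remaining eigenvalues are those of
the lower right block. No inner product is available over an arbitrary field, so the change of basis is the
matrix of the completed basis itself and not an orthogonalised one.\<close>

lemma similar_upper_triangular:
  fixes A :: "'a :: field mat"
  assumes "A \<in> carrier_mat n n" "char_poly A = (\<Prod>e\<leftarrow>es. [:- e, 1:])"
  shows "\<exists>B\<in>carrier_mat n n. upper_triangular B \<and> similar_mat A B"
  using assms
proof (induction es arbitrary: n A)
  case Nil
  then have "n = 0"
    using degree_monic_char_poly[of A n] by simp
  then show ?case
    using Nil similar_mat_refl[of A n] by (auto simp: upper_triangular_def intro!: bexI[of _ A])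
next
  case (Cons e es n A)
  let ?n1 = "n - 1"
  note A = Cons.prems(1)
  have e: "eigenvalue A e"
    unfolding eigenvalue_root_char_poly[OF A] Cons.prems(2) by simp
  then obtain v where v: "v \<in> carrier_vec n" "v \<noteq> 0\<^sub>v n" and Av: "A *\<^sub>v v = e \<cdot>\<^sub>v v"
    using A unfolding eigenvalue_def eigenvector_def by auto
  have n: "n \<noteq> 0"
    using eigenvalue_imp_nonzero_dim[OF A e] by simp
  interpret vec_space "TYPE('a)" n .
  define b where "b = basis_completion v"
  note bc = basis_completion[OF v, folded b_def]
  define W where "W = mat_of_cols n b"
  \<comment> \<open>The first column of \<open>W\<close> is \<open>v\<close>, so that of the conjugate is \<open>e\<close> times a unit vector.\<close>
  have W: "W \<in> carrier_mat n n"
    using bc(6) by (auto simp: W_def)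
  have colsW: "cols W = b"
    unfolding W_def using bc(2) by (intro cols_mat_of_cols) auto
  have "det W \<noteq> 0"
    using det_rank_iff[OF W] lin_indpt_full_rank[OF W] bc(4,5) unfolding colsW by simp
  then obtain W' where W': "W' \<in> carrier_mat n n" and W'W: "W' * W = 1\<^sub>m n" and WW': "W * W' = 1\<^sub>m n"
    using det_non_zero_imp_unit[OF W] by (auto simp: Units_def ring_mat_def)
  define A' where "A' = W' * A * W"
  have A': "A' \<in> carrier_mat n n"
    using W W' A by (auto simp: A'_def)
  have A'A: "similar_mat A' A"
    unfolding similar_mat_def
    by (intro exI[of _ W'] exI[of _ W] similar_mat_witI[OF W'W WW' _ A' A W' W]) (simp add: A'_def)
  have Wc: "col W 0 = v"
    using bc(6,7) n W by (cases b) (auto simp flip: colsW simp: cols_def upt_rec)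
  have "A' $$ (i, 0) = (if i = 0 then e else 0)" if "i < n" for i
  proof -
    have "A' = W' * (A * W)"
      using A W W' unfolding A'_def by (intro assoc_mult_mat) auto
    moreover have "col (A * W) 0 = e \<cdot>\<^sub>v v"
      using A W n by (subst col_mult2[of _ n n _ n]) (auto simp: Wc Av)
    ultimately have "A' $$ (i, 0) = e * (row W' i \<bullet> v)"
      using that A W W' n v by auto
    also have "row W' i \<bullet> v = (W' * W) $$ (i, 0)"
      using that W W' n by (simp add: Wc)
    finally show ?thesis
      using that n by (simp add: W'W)
  qed
  note col0 = this
  obtain A1 A2 A0 A3 where sp: "split_block A' 1 1 = (A1, A2, A0, A3)"
    by (cases "split_block A' 1 1") auto
  have "dim_row A' = 1 + ?n1" "dim_col A' = 1 + ?n1"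
    using A' n by auto
  note blk = split_block[OF sp this]
  have A1id: "A1 = mat 1 1 (\<lambda>_. e)"
    using sp col0[of 0] A' n unfolding split_block_def Let_def by auto
  have A0id: "A0 = 0\<^sub>m ?n1 1"
    using sp A' n by (auto simp: split_block_def Let_def col0 intro!: eq_matI)
  have cp: "char_poly A' = char_poly A1 * char_poly A3"
    using blk unfolding A0id by (metis char_poly_four_block_zeros_col)
  have "char_poly A1 = [:- e, 1:]"
    by (simp add: A1id char_poly_defs det_def sign_def)
  then have "char_poly A3 = (\<Prod>e\<leftarrow>es. [:- e, 1:])"
    using cp char_poly_similar[OF A'A] Cons.prems(2) by (simp del: mult_pCons_left)
  from Cons.IH[OF blk(4) this] obtain B where B: "B \<in> carrier_mat ?n1 ?n1" "upper_triangular B"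
    and "similar_mat A3 B" by auto
  then obtain P Q where PQ: "similar_mat_wit A3 B P Q"
    by (auto simp: similar_mat_def)
  note PQ' = similar_mat_witD2[OF blk(4) PQ]
  define C where "C = four_block_mat A1 (A2 * P) A0 B"
  have A0_eq: "A0 = P * A0 * 1\<^sub>m 1"
    unfolding A0id using PQ' by auto
  have "similar_mat_wit A' C (four_block_mat (1\<^sub>m 1) (0\<^sub>m 1 ?n1) (0\<^sub>m ?n1 1) P)
          (four_block_mat (1\<^sub>m 1) (0\<^sub>m 1 ?n1) (0\<^sub>m ?n1 1) Q)"
    unfolding blk(5) C_def
    by (rule similar_mat_wit_four_block[OF similar_mat_wit_refl[OF blk(1)] PQ _ A0_eq blk(1,4,3)])
       (use PQ' blk in auto)
  then have "similar_mat A' C"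
    unfolding similar_mat_def by blast
  then have "similar_mat A C"
    by (rule similar_mat_trans[OF similar_mat_sym[OF A'A]])
  moreover have "upper_triangular C"
    unfolding C_def A0id by (intro upper_triangular_four_block[OF _ B(1)] B(2)) (auto simp: A1id)
  moreover have "C \<in> carrier_mat n n"
    using four_block_carrier_mat[OF blk(1) B(1)] n unfolding C_def by auto
  ultimately show ?case by blast
qed

lemma monic_dvd_prod_linear:
  fixes f :: "'a :: field poly"
  assumes "f dvd (\<Prod>a\<leftarrow>as. [:- a, 1:])" "monic f"
  shows "\<exists>bs. f = (\<Prod>b\<leftarrow>bs. [:- b, 1:])"
  using assms
proof (induction as arbitrary: f)
  case Nil
  then have "f = 1"
    using monic_degree_0[of f] is_unit_iff_degree[of f] by auto
  then show ?case by (intro exI[of _ "[]"]) simp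
next
  case (Cons a as)
  from Cons.prems(1) obtain k where k: "[:- a, 1:] * (\<Prod>a\<leftarrow>as. [:- a, 1:]) = f * k"
    by (auto simp: dvd_def)
  then have "poly f a * poly k a = 0"
    by (metis dvd_triv_left mult_zero_left poly_eq_0_iff_dvd poly_mult)
  then consider "poly f a = 0" | "poly k a = 0" by auto
  then show ?case
  proof cases
    case 1
    then obtain f' where f': "f = [:- a, 1:] * f'"
      by (auto simp: poly_eq_0_iff_dvd dvd_def)
    then have "monic f'"
      using Cons.prems(2) lead_coeff_mult[of "[:- a, 1:]" f'] by simp
    moreover have "f' dvd (\<Prod>a\<leftarrow>as. [:- a, 1:])"
      using k unfolding f' mult.assoc by (metis dvd_triv_left mult_cancel_left pCons_eq_0_iff zero_neq_one)
    ultimately obtain bs where "f' = (\<Prod>b\<leftarrow>bs. [:- b, 1:])"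
      using Cons.IH by blast
    then show ?thesis
      by (intro exI[of _ "a # bs"]) (simp add: f')
  next
    case 2
    then obtain k' where "k = [:- a, 1:] * k'"
      by (auto simp: poly_eq_0_iff_dvd dvd_def)
    with k have "[:- a, 1:] * (\<Prod>a\<leftarrow>as. [:- a, 1:]) = [:- a, 1:] * (f * k')"
      by (simp only: mult.left_commute)
    then have "f dvd (\<Prod>a\<leftarrow>as. [:- a, 1:])"
      by (metis dvd_triv_left mult_cancel_left pCons_eq_0_iff zero_neq_one)
    then show ?thesis
      using Cons by blast
  qed
qed

text \<open>\<open>X - A\<close> divides \<open>X\<^sup>m - A\<^sup>m = (X\<^sup>m - 1) I\<close> in the ring of polynomial matrices; taking determinants gives
the claim. In particular the eigenvalues of \<open>A\<close> lie in the field as soon as the \<open>m\<close>-th roots of unity do.\<close>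

lemma char_poly_dvd_of_pow_eq_one:
  fixes A :: "'a :: field mat"
  assumes A: "A \<in> carrier_mat n n" and "A ^\<^sub>m m = 1\<^sub>m n"
  shows "char_poly A dvd (Polynomial.monom 1 m - 1) ^ n"
proof -
  define B where "B = map_mat (\<lambda>a. [:a:]) A"
  define Z where "Z k = Polynomial.monom (1::'a) k \<cdot>\<^sub>m 1\<^sub>m n" for k
  have B: "B \<in> carrier_mat n n" using A by (auto simp: B_def)
  have Z: "Z k \<in> carrier_mat n n" for k by (auto simp: Z_def)
  have cm: "char_poly_matrix A = Z 1 - B"
    using A unfolding char_poly_matrix_def B_def Z_def
    by (intro eq_matI) (auto simp: monom_Suc)
  have ZM: "Z k * M = Polynomial.monom 1 k \<cdot>\<^sub>m M" "M * Z k = Polynomial.monom 1 k \<cdot>\<^sub>m M"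
    if "M \<in> carrier_mat n n" for M k
    using that by (auto simp: Z_def mult_smult_distrib[of _ n n _ n] mult_smult_assoc_mat[of _ n n _ n])
  have ex: "\<exists>C\<in>carrier_mat n n. char_poly_matrix A * C = Z k - B ^\<^sub>m k" for k
  proof (induction k)
    case 0
    show ?case
      using A B Z unfolding cm by (intro bexI[of _ "0\<^sub>m n n"]) (auto simp: Z_def)
  next
    case (Suc k)
    then obtain C where C: "C \<in> carrier_mat n n" "(Z 1 - B) * C = Z k - B ^\<^sub>m k"
      by (auto simp: cm)
    have "(Z 1 - B) * (Z k + C * B) = (Z 1 - B) * Z k + ((Z 1 - B) * C) * B"
      using B C(1) Z minus_carrier_mat[OF B]
      by (simp add: mult_add_distrib_mat[of _ n n _ n] assoc_mult_mat[of _ n n _ n _ n])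
    also have "(Z 1 - B) * Z k = Z (Suc k) - Polynomial.monom 1 k \<cdot>\<^sub>m B"
      using B Z by (simp add: minus_mult_distrib_mat[of _ n n _ _ n] ZM) 
        (auto simp: Z_def mult_monom)
    also have "((Z 1 - B) * C) * B = Polynomial.monom 1 k \<cdot>\<^sub>m B - B ^\<^sub>m Suc k"
      unfolding C(2) using B Z by (simp add: minus_mult_distrib_mat[of _ n n _ _ n] ZM)
    also have "Z (Suc k) - Polynomial.monom 1 k \<cdot>\<^sub>m B + (Polynomial.monom 1 k \<cdot>\<^sub>m B - B ^\<^sub>m Suc k) = Z (Suc k) - B ^\<^sub>m Suc k"
      using B Z pow_carrier_mat[OF B, of "Suc k"] by (intro eq_matI) (auto simp del: pow_mat.simps simp: carrier_matD)
    finally show ?case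
      using B C Z by (intro bexI[of _ "Z k + C * B"]) (auto simp: cm)
  qed
  then obtain C where C: "C \<in> carrier_mat n n" "char_poly_matrix A * C = Z m - B ^\<^sub>m m"
    by blast
  interpret h: semiring_hom "\<lambda>a::'a. [:a:]"
    by unfold_locales auto
  have "B ^\<^sub>m m = 1\<^sub>m n"
    unfolding B_def h.mat_hom_pow[OF A, symmetric] assms(2)
    by (intro eq_matI) auto
  then have "char_poly_matrix A * C = (Polynomial.monom 1 m - 1) \<cdot>\<^sub>m 1\<^sub>m n"
    unfolding C by (intro eq_matI) (auto simp: Z_def)
  then have "det (char_poly_matrix A) * det C = (Polynomial.monom 1 m - 1) ^ n"
    using det_mult[of "char_poly_matrix A" n C] A C by (simp add: char_poly_matrix_closed)
  then show ?thesis
    unfolding char_poly_def by (metis dvd_triv_left)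
qed

lemma upper_triangular_mult_diag:
  fixes A B :: "'a :: semiring_0 mat"
  assumes "A \<in> carrier_mat n n" "B \<in> carrier_mat n n" "upper_triangular A" "upper_triangular B"
  shows "upper_triangular (A * B)" "i < n \<Longrightarrow> (A * B) $$ (i, i) = A $$ (i, i) * B $$ (i, i)"
proof -
  have eq: "(A * B) $$ (i, j) = (\<Sum>k<n. A $$ (i, k) * B $$ (k, j))" if "i < n" "j < n" for i j
    using assms that by (simp add: scalar_prod_def atLeast0LessThan)
  show "upper_triangular (A * B)"
  proof (rule upper_triangularI)
    fix i j assume ij: "j < i" "i < dim_row (A * B)"
    have "A $$ (i, k) * B $$ (k, j) = 0" if "k < n" for k
      using ij that assms upper_triangularD[OF assms(3), of k i] upper_triangularD[OF assms(4), of j k]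
      by (cases "k < i") auto
    then show "(A * B) $$ (i, j) = 0"
      using ij assms by (subst eq) auto
  qed
  show "(A * B) $$ (i, i) = A $$ (i, i) * B $$ (i, i)" if "i < n"
  proof -
    have "A $$ (i, k) * B $$ (k, i) = 0" if "k < n" "k \<noteq> i" for k
      using \<open>i < n\<close> that assms upper_triangularD[OF assms(3), of k i] upper_triangularD[OF assms(4), of i k]
      by (cases "k < i") auto
    then have "(\<Sum>k<n. A $$ (i, k) * B $$ (k, i)) = (\<Sum>k\<in>{i}. A $$ (i, k) * B $$ (k, i))"
      by (intro sum.mono_neutral_right) (use that in auto)
    then show ?thesis using that by (simp add: eq)
  qed
qed

lemma upper_triangular_pow_diag:
  fixes A :: "'a :: semiring_1 mat"
  assumes "A \<in> carrier_mat n n" "upper_triangular A"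
  shows "upper_triangular (A ^\<^sub>m k) \<and> diag_mat (A ^\<^sub>m k) = map (\<lambda>x. x ^ k) (diag_mat A)"
proof (induction k)
  case 0
  show ?case using assms by (auto simp: diag_mat_def intro!: nth_equalityI)
next
  case (Suc k)
  have A: "A ^\<^sub>m k \<in> carrier_mat n n" using assms by simp
  have "(A ^\<^sub>m k * A) $$ (i, i) = (A $$ (i, i)) ^ Suc k" if "i < n" for i
  proof -
    have "map (\<lambda>i. (A ^\<^sub>m k) $$ (i, i)) [0..<n] = map (\<lambda>i. A $$ (i, i) ^ k) [0..<n]"
      using Suc assms A by (simp add: diag_mat_def o_def carrier_matD)
    then have "(A ^\<^sub>m k) $$ (i, i) = A $$ (i, i) ^ k"
      using that by (metis (no_types, lifting) add_0 diff_zero nth_map_upt)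
    then show ?thesis
      using upper_triangular_mult_diag(2)[OF A assms(1)] Suc assms that
      by (simp add: power_commutes)
  qed
  then show ?case
    using Suc assms upper_triangular_mult_diag(1)[OF A assms(1)] A
    by (auto simp: diag_mat_def carrier_matD)
qed

lemma proots_char_poly_upper_triangular:
  fixes A :: "'a :: field mat"
  assumes "A \<in> carrier_mat n n" "upper_triangular A"
  shows "proots (char_poly A) = mset (diag_mat A)"
proof -
  have *: "proots (\<Prod>e\<leftarrow>es. [:- e, 1:]) = mset es" for es :: "'a list"
  proof (induction es)
    case (Cons e es)
    have "(\<Prod>e\<leftarrow>es. [:- e, 1:]) \<noteq> 0"
      by (auto simp: prod_list_zero_iff)
    then show ?case
      using Cons by (simp add: proots_mult del: mult_pCons_left)
  qed simp
  show ?thesis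
    unfolding char_poly_upper_triangular[OF assms] * ..
qed

section \<open>Kronecker products\<close>

definition kron :: "'a :: semiring_0 mat \<Rightarrow> 'a mat \<Rightarrow> 'a mat" where
  "kron A B = mat (dim_row A * dim_row B) (dim_col A * dim_col B)
     (\<lambda>(i, j). A $$ (i div dim_row B, j div dim_col B) * B $$ (i mod dim_row B, j mod dim_col B))"

lemma kron_carrier [simp, intro]:
  "A \<in> carrier_mat a b \<Longrightarrow> B \<in> carrier_mat c d \<Longrightarrow> kron A B \<in> carrier_mat (a * c) (b * d)"
  by (auto simp: kron_def)

lemma div_mod_less_mult:
  "i < a * c \<Longrightarrow> i div c < a" "i < a * c \<Longrightarrow> i mod c < (c::nat)"
  by (auto simp: less_mult_imp_div_less intro!: mod_less_divisor Nat.gr0I)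

lemma kron_index:
  assumes "A \<in> carrier_mat a b" "B \<in> carrier_mat c d" "i < a * c" "j < b * d"
  shows "kron A B $$ (i, j) = A $$ (i div c, j div d) * B $$ (i mod c, j mod d)"
  using assms by (auto simp: kron_def)

lemma sum_div_mod:
  "(\<Sum>k<a * c. f (k div c) (k mod c)) = (\<Sum>i<a. \<Sum>j<c. f i j)" for c :: nat
proof (cases "c = 0")
  case False
  have index_lt: "i * c + j < a * c" if "i < a" "j < c" for i j
    using that mult_le_mono1[of "Suc i" a c] by simp
  show ?thesis
    unfolding sum.cartesian_product
    by (rule sum.reindex_bij_witness[of _ "\<lambda>(i, j). i * c + j" "\<lambda>k. (k div c, k mod c)"])
       (use False in \<open>auto simp: div_mod_less_mult intro!: index_lt\<close>)
qed simp

lemma kron_mult: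
  fixes A B C D :: "'a :: comm_semiring_0 mat"
  assumes "A \<in> carrier_mat a b" "B \<in> carrier_mat c d" "C \<in> carrier_mat b e" "D \<in> carrier_mat d f"
  shows "kron A B * kron C D = kron (A * C) (B * D)"
proof (rule eq_matI)
  fix i j assume "i < dim_row (kron (A * C) (B * D))" "j < dim_col (kron (A * C) (B * D))"
  then have i: "i < a * c" and j: "j < e * f"
    using assms by (auto simp: kron_def)
  note ij = div_mod_less_mult[OF i] div_mod_less_mult[OF j]
  have "(kron A B * kron C D) $$ (i, j) = (\<Sum>k<b * d. kron A B $$ (i, k) * kron C D $$ (k, j))"
    using i j carrier_matD[OF kron_carrier[OF assms(1,2)]] carrier_matD[OF kron_carrier[OF assms(3,4)]]
    by (simp add: scalar_prod_def atLeast0LessThan)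
  also have "\<dots> = (\<Sum>k<b * d. (A $$ (i div c, k div d) * B $$ (i mod c, k mod d)) *
                             (C $$ (k div d, j div f) * D $$ (k mod d, j mod f)))"
    by (intro sum.cong) (simp_all add: kron_index[OF assms(1,2) i] kron_index[OF assms(3,4) _ j])
  also have "\<dots> = (\<Sum>k<b. \<Sum>l<d. (A $$ (i div c, k) * B $$ (i mod c, l)) *
                             (C $$ (k, j div f) * D $$ (l, j mod f)))"
    by (rule sum_div_mod)
  also have "\<dots> = (\<Sum>k<b. A $$ (i div c, k) * C $$ (k, j div f)) *
                  (\<Sum>l<d. B $$ (i mod c, l) * D $$ (l, j mod f))"
    by (simp add: sum_product mult_ac)
  also have "\<dots> = (A * C) $$ (i div c, j div f) * (B * D) $$ (i mod c, j mod f)"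
    using assms ij by (auto simp: scalar_prod_def atLeast0LessThan)
  also have "\<dots> = kron (A * C) (B * D) $$ (i, j)"
    by (rule kron_index[of _ a e, symmetric]) (use assms i j in auto)
  finally show "(kron A B * kron C D) $$ (i, j) = kron (A * C) (B * D) $$ (i, j)" .
qed (use assms in \<open>auto simp: kron_def\<close>)

lemma kron_one: "kron (1\<^sub>m a) (1\<^sub>m b) = (1\<^sub>m (a * b) :: 'a :: semiring_1 mat)"
proof (rule eq_matI)
  fix i j assume "i < dim_row (1\<^sub>m (a * b) :: 'a mat)" "j < dim_col (1\<^sub>m (a * b) :: 'a mat)"
  then have i: "i < a * b" and j: "j < a * b" by auto
  have "i = j" if "i div b = j div b" "i mod b = j mod b"
    using that by (metis div_mult_mod_eq)
  then show "kron (1\<^sub>m a) (1\<^sub>m b) $$ (i, j) = (1\<^sub>m (a * b) :: 'a mat) $$ (i, j)"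
    using div_mod_less_mult[OF i] div_mod_less_mult[OF j] i j
    by (auto simp: kron_index[of _ a a _ b b])
qed (auto simp: kron_def)

lemma similar_kron:
  fixes A A' B B' :: "'a :: field mat"
  assumes "A \<in> carrier_mat n n" "B \<in> carrier_mat m m" "similar_mat A A'" "similar_mat B B'"
  shows "similar_mat (kron A B) (kron A' B')"
proof -
  obtain P Q where "similar_mat_wit A A' P Q" using assms by (auto simp: similar_mat_def)
  note P = similar_mat_witD2[OF assms(1) this]
  obtain R S where "similar_mat_wit B B' R S" using assms by (auto simp: similar_mat_def)
  note R = similar_mat_witD2[OF assms(2) this]
  have "kron A B = kron P R * kron A' B' * kron Q S"
    using P R by (simp add: kron_mult[of _ n n _ m m _ n _ m])
  then show ?thesis
    unfolding similar_mat_def using P R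
    by (intro exI[of _ "kron P R"] exI[of _ "kron Q S"] similar_mat_witI[of _ _ "n * m"])
       (auto simp: kron_mult[of _ n n _ m m _ n _ m] kron_one)
qed

text \<open>The indices of a Kronecker product are pairs in lexicographic order, so below the diagonal one of the two
factors is taken below its own diagonal.\<close>

lemma upper_triangular_kron:
  assumes "A \<in> carrier_mat n n" "B \<in> carrier_mat m m" "upper_triangular A" "upper_triangular B"
  shows "upper_triangular (kron A B)"
proof (rule upper_triangularI)
  fix i j assume ji: "j < i" and "i < dim_row (kron A B)"
  then have i: "i < n * m" and j: "j < n * m" using assms by (auto simp: kron_def)
  consider "j div m < i div m" | "j div m = i div m" "j mod m < i mod m"
    using ji by (metis div_le_mono div_mult_mod_eq le_less nat_add_left_cancel_less)
  then show "kron A B $$ (i, j) = 0"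
    using assms div_mod_less_mult[OF i] unfolding kron_index[OF assms(1,2) i j]
    by cases (auto simp: upper_triangularD)
qed

lemma sum_diag_kron:
  assumes "A \<in> carrier_mat n n" "B \<in> carrier_mat m m"
  shows "(\<Sum>x\<in>#mset (diag_mat (kron A B)). f x) =
         (\<Sum>x\<in>#mset (diag_mat A). \<Sum>y\<in>#mset (diag_mat B). f (x * y))"
proof -
  have sl: "sum_list (map g [0..<k]) = (\<Sum>i<k. g i)" for g :: "nat \<Rightarrow> 'b" and k
    by (simp add: interv_sum_list_conv_sum_set_nat atLeast0LessThan)
  have "(\<Sum>x\<in>#mset (diag_mat (kron A B)). f x) = (\<Sum>i<n * m. f (kron A B $$ (i, i)))"
    using assms by (simp add: diag_mat_def kron_def sum_mset_sum_list o_def sl flip: mset_map)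
  also have "\<dots> = (\<Sum>i<n * m. f (A $$ (i div m, i div m) * B $$ (i mod m, i mod m)))"
    by (intro sum.cong) (auto simp: kron_index[OF assms])
  also have "\<dots> = (\<Sum>i<n. \<Sum>j<m. f (A $$ (i, i) * B $$ (j, j)))"
    by (rule sum_div_mod[of "\<lambda>i j. f (A $$ (i, i) * B $$ (j, j))"])
  also have "\<dots> = (\<Sum>x\<in>#mset (diag_mat A). \<Sum>y\<in>#mset (diag_mat B). f (x * y))"
    using assms by (simp add: diag_mat_def sum_mset_sum_list o_def sl flip: mset_map)
  finally show ?thesis .
qed

section \<open>Integral elements over a subring of a field\<close>

locale subring_set =
  fixes R :: "'a :: field set"
  assumes zero [simp, intro]: "0 \<in> R" and one [simp, intro]: "1 \<in> R"
    and add [intro]: "x \<in> R \<Longrightarrow> y \<in> R \<Longrightarrow> x + y \<in> R"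
    and mult [intro]: "x \<in> R \<Longrightarrow> y \<in> R \<Longrightarrow> x * y \<in> R"
    and uminus [intro]: "x \<in> R \<Longrightarrow> - x \<in> R"
begin

lemma diff [intro]: "x \<in> R \<Longrightarrow> y \<in> R \<Longrightarrow> x - y \<in> R"
  using add[of x "- y"] uminus by simp

lemma sum [intro]: "(\<And>i. i \<in> I \<Longrightarrow> f i \<in> R) \<Longrightarrow> sum f I \<in> R"
  by (induction I rule: infinite_finite_induct) auto

lemma power [intro]: "x \<in> R \<Longrightarrow> x ^ n \<in> R"
  by (induction n) auto

lemma of_nat [simp, intro]: "of_nat n \<in> R"
  by (induction n) auto

definition integral :: "'a \<Rightarrow> bool" where
  "integral x \<longleftrightarrow> (\<exists>f. lead_coeff f = 1 \<and> range (poly.coeff f) \<subseteq> R \<and> poly f x = 0)"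

lemma coeff_char_poly:
  assumes A: "A \<in> carrier_mat n n" and "\<And>i j. i < n \<Longrightarrow> j < n \<Longrightarrow> A $$ (i, j) \<in> R"
  shows "poly.coeff (char_poly A) k \<in> R"
proof -
  define S where "S = {f :: 'a poly. range (poly.coeff f) \<subseteq> R}"
  have S_mult: "f * g \<in> S" if "f \<in> S" "g \<in> S" for f g
    using that by (auto simp: S_def coeff_mult intro!: sum mult)
  have S_sum: "sum f I \<in> S" if "\<And>i. i \<in> I \<Longrightarrow> f i \<in> S" for f and I :: "(nat \<Rightarrow> nat) set"
    using that by (auto simp: S_def coeff_sum intro!: sum)
  have S_1: "1 \<in> S"
    by (auto simp: S_def coeff_1)
  have S_prod: "prod f I \<in> S" if "\<And>i. i \<in> I \<Longrightarrow> f i \<in> S" for f and I :: "nat set"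
    using that by (induction I rule: infinite_finite_induct) (auto intro: S_mult S_1)
  have S_sign: "signof p \<in> S" for p
    using S_1 by (auto simp: S_def sign_def)
  have entry: "char_poly_matrix A $$ (i, j) \<in> S" if "i < n" "j < n" for i j
    using that assms by (auto simp: char_poly_matrix_def S_def coeff_pCons intro!: uminus split: nat.splits)
  have "char_poly A \<in> S"
    unfolding char_poly_def det_def'[OF char_poly_matrix_closed[OF A]]
  proof (intro S_sum S_mult S_sign S_prod entry)
    fix p i assume "p \<in> {p. p permutes {0..<n}}" "i \<in> {0..<n}"
    then show "i < n" "p i < n"
      using permutes_in_image[of p "{0..<n}" i] by auto
  qed
  then show ?thesis by (auto simp: S_def)
qed

text \<open>The determinant trick: \<open>x\<close> is an eigenvalue of a matrix over \<open>R\<close>, hence a root of its characteristic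
polynomial, which is monic with coefficients in \<open>R\<close>. One nonzero generator ensures that the vector of
generators is an eigenvector.\<close>

lemma integral_of_finite_module:
  fixes v :: "nat \<Rightarrow> 'a"
  assumes "i0 < n" "v i0 \<noteq> 0"
    and "\<And>i. i < n \<Longrightarrow> \<exists>c. range c \<subseteq> R \<and> x * v i = (\<Sum>j<n. c j * v j)"
  shows "integral x"
proof -
  obtain c where c: "range (c i) \<subseteq> R" "x * v i = (\<Sum>j<n. c i j * v j)" if "i < n" for i
    using assms(3) by metis
  define A where "A = mat n n (\<lambda>(i, j). c i j)"
  have A: "A \<in> carrier_mat n n" by (simp add: A_def)
  have "A *\<^sub>v vec n v = x \<cdot>\<^sub>v vec n v"
    using c by (intro eq_vecI) (auto simp: A_def scalar_prod_def atLeast0LessThan)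
  moreover have "vec n v \<noteq> 0\<^sub>v n"
    using assms(1,2) by (metis index_vec index_zero_vec(1))
  ultimately have "eigenvalue A x"
    using A unfolding eigenvalue_def eigenvector_def by (intro exI[of _ "vec n v"]) auto
  then have "poly (char_poly A) x = 0"
    using eigenvalue_root_char_poly[OF A] by simp
  moreover have "range (poly.coeff (char_poly A)) \<subseteq> R"
    using c(1) by (force simp: A_def intro!: coeff_char_poly[of _ n])
  ultimately show ?thesis
    using degree_monic_char_poly[OF A] unfolding integral_def by (intro exI[of _ "char_poly A"]) auto
qed

lemma integral_powers:
  assumes "integral x"
  obtains n where "n > 0" "\<And>a. \<exists>c. range c \<subseteq> R \<and> x ^ a = (\<Sum>i<n. c i * x ^ i)"
proof -
  obtain f where f: "lead_coeff f = 1" "range (poly.coeff f) \<subseteq> R" "poly f x = 0"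
    using assms by (auto simp: integral_def)
  define n where "n = degree f"
  have "n > 0"
  proof (rule ccontr)
    assume "\<not> n > 0"
    then have "f = 1" using monic_degree_0[of f] f(1) unfolding n_def by simp
    then show False using f(3) by simp
  qed
  have xn: "x ^ n = (\<Sum>i<n. - poly.coeff f i * x ^ i)"
    using f(1,3) unfolding poly_altdef n_def[symmetric]
    by (simp add: lessThan_Suc_atMost[symmetric] sum_negf eq_neg_iff_add_eq_0 add.commute)
  have "\<exists>c. range c \<subseteq> R \<and> x ^ a = (\<Sum>i<n. c i * x ^ i)" for a
  proof (induction a)
    case 0
    show ?case
      by (intro exI[of _ "\<lambda>i. if i = 0 then 1 else 0"])
         (use \<open>n > 0\<close> in \<open>auto simp: if_distrib[of "\<lambda>c. c * _"] sum.delta cong: if_cong\<close>)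
  next
    case (Suc a)
    then obtain c where c: "range c \<subseteq> R" "x ^ a = (\<Sum>i<n. c i * x ^ i)" by blast
    \<comment> \<open>Multiplication by \<open>x\<close> shifts the coefficients; the top one is reduced by the equation for \<open>x\<^sup>n\<close>.\<close>
    define d where "d i = (if i = 0 then 0 else c (i - 1)) - c (n - 1) * poly.coeff f i" for i
    obtain m where m: "n = Suc m" using \<open>n > 0\<close> gr0_conv_Suc by blast
    have "x ^ Suc a = (\<Sum>i<n. c i * x ^ Suc i)"
      by (simp add: c sum_distrib_left mult_ac)
    also have "\<dots> = (\<Sum>i<m. c i * x ^ Suc i) + c m * x ^ n"
      by (simp add: m)
    also have "(\<Sum>i<m. c i * x ^ Suc i) = (\<Sum>i<n. (if i = 0 then 0 else c (i - 1)) * x ^ i)"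
      unfolding m by (subst sum.lessThan_Suc_shift) simp
    also have "c m * x ^ n = (\<Sum>i<n. - (c m * poly.coeff f i) * x ^ i)"
      unfolding xn by (simp add: sum_distrib_left mult_ac)
    also have "(\<Sum>i<n. (if i = 0 then 0 else c (i - 1)) * x ^ i) + \<dots> = (\<Sum>i<n. d i * x ^ i)"
      unfolding sum.distrib[symmetric] by (intro sum.cong) (auto simp: d_def m algebra_simps)
    finally show ?case
      using c(1) f(2)
      by (intro exI[of _ d] conjI subsetI) (auto simp: d_def image_subset_iff intro!: diff mult uminus)
  qed
  with \<open>n > 0\<close> show ?thesis by (rule that)
qed

text \<open>The products \<open>x\<^sup>i y\<^sup>j\<close> with \<open>i\<close> and \<open>j\<close> below the degrees of the two equations span a finitely generated
\<open>R\<close>-module that is stable under \<open>x\<close> and \<open>y\<close>.\<close>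

lemma integral_add_mult:
  assumes "integral x" "integral y"
  shows "integral (x + y)" "integral (x * y)"
proof -
  obtain n where n: "n > 0" "\<And>a. \<exists>c. range c \<subseteq> R \<and> x ^ a = (\<Sum>i<n. c i * x ^ i)"
    using integral_powers[OF assms(1)] by blast
  obtain m where m: "m > 0" "\<And>a. \<exists>c. range c \<subseteq> R \<and> y ^ a = (\<Sum>i<m. c i * y ^ i)"
    using integral_powers[OF assms(2)] by blast
  define v where "v k = x ^ (k div m) * y ^ (k mod m)" for k
  have span: "\<exists>c. range c \<subseteq> R \<and> x ^ a * y ^ b = (\<Sum>k<n * m. c k * v k)" for a b
  proof -
    obtain c where c: "range c \<subseteq> R" "x ^ a = (\<Sum>i<n. c i * x ^ i)" using n by blast
    obtain d where d: "range d \<subseteq> R" "y ^ b = (\<Sum>i<m. d i * y ^ i)" using m by blast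
    have "x ^ a * y ^ b = (\<Sum>i<n. \<Sum>j<m. (c i * x ^ i) * (d j * y ^ j))"
      unfolding c(2) d(2) by (rule sum_product)
    also have "\<dots> = (\<Sum>k<n * m. (c (k div m) * x ^ (k div m)) * (d (k mod m) * y ^ (k mod m)))"
      by (rule sum_div_mod[symmetric])
    finally show ?thesis
      using c(1) d(1)
      by (intro exI[of _ "\<lambda>k. c (k div m) * d (k mod m)"]) (auto simp: v_def mult_ac image_subset_iff)
  qed
  have v0: "0 < n * m" "v 0 \<noteq> 0"
    using n m by (auto simp: v_def)
  show "integral (x * y)"
  proof (rule integral_of_finite_module[of 0 "n * m" v, OF v0])
    fix i
    show "\<exists>c. range c \<subseteq> R \<and> x * y * v i = (\<Sum>j<n * m. c j * v j)"
      using span[of "Suc (i div m)" "Suc (i mod m)"] by (simp add: v_def mult_ac)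
  qed
  show "integral (x + y)"
  proof (rule integral_of_finite_module[of 0 "n * m" v, OF v0])
    fix i
    obtain c where c: "range c \<subseteq> R" "x * v i = (\<Sum>k<n * m. c k * v k)"
      using span[of "Suc (i div m)" "i mod m"] by (auto simp: v_def mult_ac)
    obtain d where d: "range d \<subseteq> R" "y * v i = (\<Sum>k<n * m. d k * v k)"
      using span[of "i div m" "Suc (i mod m)"] by (auto simp: v_def mult_ac)
    have "(x + y) * v i = (\<Sum>k<n * m. (c k + d k) * v k)"
      by (simp add: ring_distribs c d sum.distrib)
    then show "\<exists>c. range c \<subseteq> R \<and> (x + y) * v i = (\<Sum>j<n * m. c j * v j)"
      using c(1) d(1) by (intro exI[of _ "\<lambda>k. c k + d k"]) auto
  qed
qed

lemma integral_base: "x \<in> R \<Longrightarrow> integral x"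
  unfolding integral_def by (intro exI[of _ "[:- x, 1:]"]) (auto simp: coeff_pCons split: nat.splits)

lemma integral_root_of_unity:
  assumes "x ^ m = 1" "m > 0"
  shows "integral x"
  unfolding integral_def
proof (intro exI[of _ "Polynomial.monom 1 m - 1"] conjI)
  have "degree (Polynomial.monom 1 m - 1 :: 'a poly) = m"
    using assms(2) by (intro antisym degree_le le_degree) (auto simp: coeff_1)
  then show "lead_coeff (Polynomial.monom 1 m - 1 :: 'a poly) = 1"
    using assms(2) by (simp add: coeff_1)
  show "range (poly.coeff (Polynomial.monom 1 m - 1 :: 'a poly)) \<subseteq> R"
    by (auto simp: coeff_1)
  show "poly (Polynomial.monom 1 m - 1) x = 0"
    using assms(1) by (simp add: poly_monom)
qed

lemma subring_set_integral: "subring_set {x. integral x}"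
proof
  show "- x \<in> {x. integral x}" if "x \<in> {x. integral x}" for x
    using integral_add_mult(2)[of "-1" x] that integral_base[of "-1"] by auto
qed (auto intro: integral_base integral_add_mult)

end

section \<open>The residue field of the integral closure of the p-adic integers\<close>

text \<open>\<open>p\<close>-adic integers are usually produced by a sequence of integers whose terms are compatible only modulo the
powers of \<open>p\<close>; reducing the terms gives the required representatives.\<close>

lemma mod_power_in_padic_ints:
  assumes "p > 0" "\<And>n. h (Suc n) mod int p ^ n = h n mod int p ^ n"
  shows "(\<lambda>n. h n mod int p ^ n) \<in> carrier (padic_ints p)"
  using assms by (auto simp: padic_ints_def mod_mod_cancel)

lemma padic_intsD:
  assumes "f \<in> carrier (padic_ints p)"
  shows "f (Suc n) mod int p ^ n = f n mod int p ^ n" "f n mod int p ^ n = f n"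
  using assms by (auto simp: padic_ints_def)

locale padic_setup =
  fixes p :: nat and \<iota> :: "(nat \<Rightarrow> int) \<Rightarrow> 'k::alg_closed_field" and red :: "'k \<Rightarrow> 'f::field"
  assumes prime_p: "prime p" and closure: "padic_alg_closure p \<iota>" and resid: "residue_map p \<iota> red"
begin

abbreviation Zp :: "(nat \<Rightarrow> int) set" where "Zp \<equiv> carrier (padic_ints p)"

lemma p_pos: "p > 0" using prime_p prime_gt_0_nat by blast

lemma iota_hom:
  assumes "f \<in> Zp" "g \<in> Zp"
  shows "\<iota> (\<lambda>n. (f n * g n) mod int p ^ n) = \<iota> f * \<iota> g"
    and "\<iota> (\<lambda>n. (f n + g n) mod int p ^ n) = \<iota> f + \<iota> g"
    and "\<iota> (\<lambda>n. 1 mod int p ^ n) = 1"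
proof -
  have "\<iota> \<in> Ring.ring_hom (padic_ints p) ring_of_type_algebra"
    using closure by (simp only: padic_alg_closure_def)
  then show "\<iota> (\<lambda>n. (f n * g n) mod int p ^ n) = \<iota> f * \<iota> g"
    and "\<iota> (\<lambda>n. (f n + g n) mod int p ^ n) = \<iota> f + \<iota> g"
    and "\<iota> (\<lambda>n. 1 mod int p ^ n) = 1"
    using assms unfolding Ring.ring_hom_def ring_of_type_algebra_def padic_ints_def by simp_all
qed

lemma Zp_mult: "f \<in> Zp \<Longrightarrow> g \<in> Zp \<Longrightarrow> (\<lambda>n. (f n * g n) mod int p ^ n) \<in> Zp"
  by (intro mod_power_in_padic_ints p_pos mod_mult_cong padic_intsD(1))

lemma Zp_add: "f \<in> Zp \<Longrightarrow> g \<in> Zp \<Longrightarrow> (\<lambda>n. (f n + g n) mod int p ^ n) \<in> Zp"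
  by (intro mod_power_in_padic_ints p_pos mod_add_cong padic_intsD(1))

lemma Zp_const: "(\<lambda>n. k mod int p ^ n) \<in> Zp"
  by (intro mod_power_in_padic_ints p_pos) simp

lemma iota_zero: "\<iota> (\<lambda>n. 0) = 0"
proof -
  have "\<iota> (\<lambda>n. 0) = \<iota> (\<lambda>n. 0) + \<iota> (\<lambda>n. 0)"
    using iota_hom(2)[OF Zp_const[of 0] Zp_const[of 0]] by (simp only: mod_0 add_0_left)
  then show ?thesis by (simp only: add_cancel_right_right)
qed

lemma iota_of_nat: "\<iota> (\<lambda>n. int k mod int p ^ n) = of_nat k"
proof (induction k)
  case (Suc k)
  have "\<iota> (\<lambda>n. int (Suc k) mod int p ^ n) =
        \<iota> (\<lambda>n. (int k mod int p ^ n + 1 mod int p ^ n) mod int p ^ n)"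
    by (simp add: mod_simps add.commute)
  then show ?case
    using iota_hom(2)[OF Zp_const[of "int k"] Zp_const[of 1]] iota_hom(3)[OF Zp_const Zp_const] Suc
    by simp
qed (simp add: iota_zero)

sublocale Zp: subring_set "\<iota> ` Zp"
proof
  show "0 \<in> \<iota> ` Zp" using iota_zero Zp_const[of 0] by force
  show "1 \<in> \<iota> ` Zp" using iota_hom(3)[OF Zp_const Zp_const] by (rule image_eqI[OF sym Zp_const])
  fix x y assume "x \<in> \<iota> ` Zp" "y \<in> \<iota> ` Zp"
  then obtain f g where fg: "f \<in> Zp" "g \<in> Zp" "x = \<iota> f" "y = \<iota> g" by blast
  show "x + y \<in> \<iota> ` Zp" "x * y \<in> \<iota> ` Zp"
    unfolding fg iota_hom(1,2)[OF fg(1,2), symmetric]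
    by (intro imageI Zp_add Zp_mult fg)+
next
  fix x assume "x \<in> \<iota> ` Zp"
  then obtain f where f: "f \<in> Zp" "x = \<iota> f" by blast
  define g where "g = (\<lambda>n. (- f n) mod int p ^ n)"
  have g: "g \<in> Zp"
    unfolding g_def by (intro mod_power_in_padic_ints p_pos mod_minus_cong padic_intsD(1) f)
  have "\<iota> f + \<iota> g = \<iota> (\<lambda>n. (f n + g n) mod int p ^ n)"
    using iota_hom(2)[OF f(1) g] by simp
  also have "\<dots> = 0"
    by (simp add: g_def mod_add_right_eq iota_zero)
  finally show "- x \<in> \<iota> ` Zp"
    unfolding f(2) using g by (intro image_eqI[of _ _ g] minus_unique)
qed

text \<open>The geometric series \<open>\<Sum>\<^sub>i (-p b)\<^sup>i\<close> inverts \<open>1 + p b\<close>; modulo \<open>p\<^sup>n\<close> its first \<open>n\<close> terms suffice.\<close>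

lemma one_plus_p_unit:
  assumes "b \<in> \<iota> ` Zp"
  shows "\<exists>c\<in>\<iota> ` Zp. (1 + of_nat p * b) * c = 1"
proof -
  obtain f where f: "f \<in> Zp" "b = \<iota> f" using assms by blast
  define h where "h n = (\<Sum>i<n. (- (int p * f n)) ^ i)" for n
  have h: "(\<lambda>n. h n mod int p ^ n) \<in> Zp"
  proof (intro mod_power_in_padic_ints p_pos)
    fix n
    have "h (Suc n) = (\<Sum>i<n. (- (int p * f (Suc n))) ^ i) + (- f (Suc n)) ^ n * int p ^ n"
      by (simp add: h_def flip: power_mult_distrib) (simp add: mult.commute)
    then have "h (Suc n) mod int p ^ n = (\<Sum>i<n. (- (int p * f (Suc n))) ^ i) mod int p ^ n"
      by simp
    also have "\<dots> = h n mod int p ^ n"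
    proof -
      have "(- (int p * f (Suc n))) ^ i mod int p ^ n = (- (int p * f n)) ^ i mod int p ^ n" for i
        using mod_minus_cong[OF mod_mult_cong[OF refl padic_intsD(1)[OF f(1)]]] by (metis power_mod)
      then show ?thesis
        unfolding h_def by (subst (1 2) mod_sum_eq[symmetric]) (simp only:)
    qed
    finally show "h (Suc n) mod int p ^ n = h n mod int p ^ n" .
  qed
  define q where "q = (\<lambda>n. int p mod int p ^ n)"
  define e where "e = (\<lambda>n. (1 mod int p ^ n + (q n * f n) mod int p ^ n) mod int p ^ n)"
  have q: "q \<in> Zp" unfolding q_def by (rule Zp_const)
  have e: "e \<in> Zp" unfolding e_def by (intro Zp_add Zp_const Zp_mult q f)
  have "(1 + of_nat p * b) = \<iota> e"
    unfolding e_def f(2) using iota_hom(2)[OF Zp_const[of 1] Zp_mult[OF q f(1)]] iota_hom(1)[OF q f(1)]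
      iota_hom(3)[OF f(1) f(1)] iota_of_nat[of p] by (simp add: q_def)
  then have "(1 + of_nat p * b) * \<iota> (\<lambda>n. h n mod int p ^ n) =
      \<iota> (\<lambda>n. (e n * (h n mod int p ^ n)) mod int p ^ n)"
    using iota_hom(1)[OF e h] by simp
  also have "(\<lambda>n. (e n * (h n mod int p ^ n)) mod int p ^ n) = (\<lambda>n. 1 mod int p ^ n)"
  proof
    fix n
    have "(e n * (h n mod int p ^ n)) mod int p ^ n = ((1 + int p * f n) * h n) mod int p ^ n"
      by (simp add: e_def q_def mod_simps)
    also have "(1 + int p * f n) * h n = 1 - (- (int p * f n)) ^ n"
      unfolding h_def one_diff_power_eq by simp
    also have "\<dots> = 1 - (- f n) ^ n * int p ^ n"
      by (simp flip: power_mult_distrib) (simp add: mult.commute)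
    also have "\<dots> mod int p ^ n = 1 mod int p ^ n"
      by (metis diff_zero mod_diff_right_eq mod_mult_self2_is_0)
    finally show "(e n * (h n mod int p ^ n)) mod int p ^ n = 1 mod int p ^ n" .
  qed
  finally show ?thesis
    using h iota_hom(3)[OF h h] by auto
qed

lemma of_nat_neq_0: "k > 0 \<Longrightarrow> (of_nat k :: 'k) \<noteq> 0"
proof
  assume k: "k > 0" and "(of_nat k :: 'k) = 0"
  then have "\<iota> (\<lambda>n. int k mod int p ^ n) = \<iota> (\<lambda>n. 0 mod int p ^ n)"
    by (simp add: iota_of_nat iota_zero)
  then have "(\<lambda>n. int k mod int p ^ n) = (\<lambda>n. 0 mod int p ^ n)"
    using closure inj_onD[OF _ _ Zp_const Zp_const] unfolding padic_alg_closure_def by blast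
  then have "int k mod int p ^ k = 0" by (metis mod_0)
  moreover have "k < p ^ k"
    using prime_gt_1_nat[OF prime_p] by (intro power_gt_expt) simp
  then have "int k < int p ^ k" by (metis of_nat_less_iff of_nat_power)
  ultimately show False using k by simp
qed

abbreviation \<O> :: "'k set" where "\<O> \<equiv> carrier (integral_closure p \<iota>)"

lemma integral_closure_simps:
  "\<O> = {x. Zp.integral x}"
  "monoid.mult (integral_closure p \<iota>) = (*)" "one (integral_closure p \<iota>) = 1"
  unfolding integral_closure_def Zp.integral_def ring_of_type_algebra_def by simp_all

sublocale O: subring_set \<O>
  unfolding integral_closure_simps by (rule Zp.subring_set_integral)

lemma red_hom:
  "x \<in> \<O> \<Longrightarrow> y \<in> \<O> \<Longrightarrow> red (x + y) = red x + red y"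
  "x \<in> \<O> \<Longrightarrow> y \<in> \<O> \<Longrightarrow> red (x * y) = red x * red y"
  "red 1 = 1"
proof -
  have "red \<in> Ring.ring_hom (integral_closure p \<iota>) ring_of_type_algebra"
    using resid by (simp only: residue_map_def)
  then show "x \<in> \<O> \<Longrightarrow> y \<in> \<O> \<Longrightarrow> red (x + y) = red x + red y"
    "x \<in> \<O> \<Longrightarrow> y \<in> \<O> \<Longrightarrow> red (x * y) = red x * red y" "red 1 = 1"
    unfolding Ring.ring_hom_def integral_closure_def ring_of_type_algebra_def by simp_all
qed

lemma red_0: "red 0 = 0"
proof -
  have "red 0 = red 0 + red 0"
    using red_hom(1)[OF O.zero O.zero] by (simp only: add_0_left)
  then show ?thesis by (simp only: add_cancel_right_right)
qed

lemma red_power: "x \<in> \<O> \<Longrightarrow> red (x ^ n) = red x ^ n"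
  by (induction n) (auto simp: red_hom O.power)

lemma red_sum: "(\<And>i. i \<in> I \<Longrightarrow> f i \<in> \<O>) \<Longrightarrow> red (sum f I) = (\<Sum>i\<in>I. red (f i))"
  by (induction I rule: infinite_finite_induct) (auto simp: red_hom red_0 O.sum)

lemma red_of_nat: "red (of_nat n) = of_nat n"
  by (induction n) (auto simp: red_hom red_0)

text \<open>Otherwise \<open>1/p\<close> is the residue of some integral \<open>x\<close>. Clearing denominators in the reduction of the
equation of \<open>x\<close> turns it into \<open>red (1 + p b) = 0\<close> with a \<open>p\<close>-adic integer \<open>b\<close>, but \<open>1 + p b\<close> is a unit.\<close>

lemma of_nat_p_eq_0: "(of_nat p :: 'f) = 0"
proof (rule ccontr)
  assume p0: "(of_nat p :: 'f) \<noteq> 0"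
  have "red ` \<O> = UNIV"
    using resid by (simp only: residue_map_def)
  then obtain x where x: "x \<in> \<O>" "1 / of_nat p = red x" by (metis UNIV_I imageE)
  then have xp: "red x * of_nat p = 1" using p0 by (simp flip: x(2))
  obtain f where f: "lead_coeff f = 1" "range (poly.coeff f) \<subseteq> \<iota> ` Zp" "poly f x = 0"
    using x(1) by (auto simp: integral_closure_simps Zp.integral_def)
  define n where "n = degree f"
  have coeff: "poly.coeff f i \<in> \<iota> ` Zp" for i using f(2) by auto
  then have coeffO: "poly.coeff f i \<in> \<O>" for i
    using Zp.integral_base by (auto simp: integral_closure_simps)
  \<comment> \<open>\<open>1 + p b\<close> is \<open>p\<^sup>n f(1/p)\<close>, and \<open>x\<close> reduces to \<open>1/p\<close>.\<close>
  define b where "b = (\<Sum>i<n. poly.coeff f i * of_nat p ^ (n - Suc i))"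
  have b: "b \<in> \<iota> ` Zp"
    unfolding b_def by (intro Zp.sum Zp.mult coeff Zp.power Zp.of_nat)
  obtain c where c: "c \<in> \<iota> ` Zp" "(1 + of_nat p * b) * c = 1"
    using one_plus_p_unit[OF b] by blast
  have bc: "b \<in> \<O>" "c \<in> \<O>" using b c(1) Zp.integral_base by (auto simp: integral_closure_simps)
  have "of_nat p * (poly.coeff f i * of_nat p ^ (n - Suc i)) = poly.coeff f i * of_nat p ^ (n - i)"
    if "i < n" for i
    using that by (simp add: mult.left_commute Suc_diff_Suc flip: power_Suc)
  then have "of_nat p * b = (\<Sum>i<n. poly.coeff f i * of_nat p ^ (n - i))"
    unfolding b_def sum_distrib_left by (intro sum.cong) auto
  then have "1 + of_nat p * b = (\<Sum>i\<le>n. poly.coeff f i * of_nat p ^ (n - i))"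
    using f(1) by (simp add: lessThan_Suc_atMost[symmetric] flip: n_def)
  also have "red \<dots> = (\<Sum>i\<le>n. red (poly.coeff f i) * of_nat p ^ (n - i))"
    by (subst red_sum) (auto simp: red_hom red_power red_of_nat coeffO O.mult O.power)
  also have "\<dots> = (\<Sum>i\<le>n. of_nat p ^ n * (red (poly.coeff f i) * red x ^ i))"
  proof (intro sum.cong refl)
    fix i assume "i \<in> {..n}"
    then have "of_nat p ^ n * red x ^ i = of_nat p ^ (n - i) * (red x * of_nat p) ^ i"
      by (simp add: power_mult_distrib flip: power_add)
    then have "of_nat p ^ n * red x ^ i = of_nat p ^ (n - i)"
      by (simp only: xp power_one mult_1_right)
    then show "red (poly.coeff f i) * of_nat p ^ (n - i) = of_nat p ^ n * (red (poly.coeff f i) * red x ^ i)"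
      by (simp add: mult_ac)
  qed
  also have "\<dots> = of_nat p ^ n * red (\<Sum>i\<le>n. poly.coeff f i * x ^ i)"
    by (subst red_sum) (auto simp: red_hom red_power x(1) coeffO O.mult O.power sum_distrib_left)
  also have "(\<Sum>i\<le>n. poly.coeff f i * x ^ i) = 0"
    using f(3) by (simp add: poly_altdef n_def)
  finally have "red (1 + of_nat p * b) = 0" by (simp add: red_0)
  then have "red ((1 + of_nat p * b) * c) = 0"
    by (subst red_hom) (auto intro: bc)
  then show False using c(2) red_hom(3) by simp
qed

lemma CHAR_f: "CHAR('f) = p"
proof -
  have "CHAR('f) dvd p" using of_nat_p_eq_0 by (simp add: of_nat_eq_0_iff_char_dvd)
  moreover have "CHAR('f) \<noteq> 1" using of_nat_CHAR[where 'a = 'f] by fastforce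
  ultimately show ?thesis using prime_p by (metis prime_nat_iff)
qed

text \<open>In characteristic \<open>p\<close> one has \<open>z\<^sup>p - 1 = (z - 1)\<^sup>p\<close>, so \<open>1\<close> is the only \<open>p\<close>-th root of unity.\<close>

lemma p_torsion_free:
  assumes "(z :: 'f) ^ p ^ k = 1"
  shows "z = 1"
  using assms
proof (induction k arbitrary: z)
  case (Suc k)
  have "(z ^ p) ^ p ^ k = 1" using Suc.prems by (simp flip: power_mult)
  then have zp: "z ^ p = 1" by (rule Suc.IH)
  have "z ^ p = ((z - 1) + 1) ^ p" by simp
  also have "\<dots> = (\<Sum>i\<le>p. of_nat (p choose i) * (z - 1) ^ i)"
    unfolding binomial_ring by simp
  also have "\<dots> = (\<Sum>i\<in>{0, p}. of_nat (p choose i) * (z - 1) ^ i)"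
  proof (intro sum.mono_neutral_right ballI)
    fix i assume "i \<in> {..p} - {0, p}"
    then have "p dvd (p choose i)" using prime_p by (intro dvd_choose_prime) auto
    then show "of_nat (p choose i) * (z - 1) ^ i = 0"
      using CHAR_f of_nat_eq_0_iff_char_dvd[where 'a = 'f] by simp
  qed auto
  also have "\<dots> = 1 + (z - 1) ^ p" using p_pos by simp
  finally show ?case using zp by simp
qed simp

end

section \<open>Lifting roots of unity\<close>

context padic_setup begin

definition mu :: "nat \<Rightarrow> 'k set" where "mu m = {\<zeta>. \<zeta> ^ m = 1}"

lemma mu_subset: "m > 0 \<Longrightarrow> mu m \<subseteq> \<O>"
  using Zp.integral_root_of_unity by (auto simp: mu_def integral_closure_simps)

text \<open>If the quotient \<open>u\<close> of the two roots of unity were not \<open>1\<close>, then \<open>1 + u + \<dots> + u\<^bsup>m-1\<^esup> = 0\<close>; but \<open>u\<close>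
reduces to \<open>1\<close>, so this sum reduces to \<open>m\<close>, which is not zero in characteristic \<open>p\<close>.\<close>

lemma red_eq_imp_eq:
  assumes m: "m > 0" "coprime p m" and "\<zeta> ^ m = 1" "\<xi> ^ m = 1" and red: "red \<zeta> = red \<xi>"
  shows "\<zeta> = \<xi>"
proof -
  have z: "\<zeta> \<in> \<O>" "\<xi> \<in> \<O>" using mu_subset[OF m(1)] assms by (auto simp: mu_def)
  define u where "u = \<zeta> * \<xi> ^ (m - 1)"
  have u: "u \<in> \<O>" using z by (auto simp: u_def)
  have um: "u ^ m = 1" using assms by (simp add: u_def power_mult_distrib flip: power_mult)
     (metis mult.commute power_mult power_one)
  have "red u = red (\<xi> ^ m)"
    using z m(1) red by (simp add: u_def red_hom red_power O.power flip: power_Suc)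
  then have ru: "red u = 1" by (simp add: assms red_hom)
  have "u = 1"
  proof (rule ccontr)
    assume "u \<noteq> 1"
    then have "(\<Sum>i<m. u ^ i) = 0" using um by (simp add: geometric_sum)
    then have "0 = red (\<Sum>i<m. u ^ i)" by (simp add: red_0)
    also have "\<dots> = of_nat m"
      using u by (subst red_sum) (auto simp: red_power ru)
    finally have "p dvd m" using CHAR_f of_nat_eq_0_iff_char_dvd[where 'a = 'f] by metis
    then show False using m(2) prime_p by (metis coprime_absorb_left not_prime_unit)
  qed
  then have "\<xi> * u = \<xi>" by simp
  moreover have "\<xi> * u = \<zeta> * \<xi> ^ m"
    using m(1) by (simp add: u_def power_eq_if)
  ultimately show ?thesis by (simp add: assms)
qed

text \<open>\<open>X\<^sup>m - 1\<close> splits and has no multiple root, since its derivative vanishes only at \<open>0\<close>.\<close>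

lemma card_mu:
  assumes "m > 0"
  shows "finite (mu m)" "card (mu m) = m"
proof -
  define P where "P = (Polynomial.monom 1 m - 1 :: 'k poly)"
  have deg: "degree P = m"
    unfolding P_def using assms by (intro antisym degree_le le_degree) (auto simp: coeff_1)
  then have P0: "P \<noteq> 0" using assms by auto
  have lc: "lead_coeff P = 1"
    unfolding deg using assms by (simp add: P_def coeff_1)
  have mu: "mu m = {x. poly P x = 0}"
    by (simp add: mu_def P_def poly_monom)
  then show "finite (mu m)" using poly_roots_finite[OF P0] by simp
  obtain A where A: "size A = m" "P = (\<Prod>x\<in>#A. [:- x, 1:])"
    using alg_closed_imp_factorization[OF P0] deg lc by auto
  have "count A x \<le> 1" for x
  proof (rule ccontr)
    assume "\<not> count A x \<le> 1"
    then have "x \<in># A" "x \<in># A - {#x#}"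
      by (simp_all flip: count_greater_zero_iff)
    then obtain C where "A = {#x, x#} + C"
      by (metis add_mset_add_single insert_DiffM union_mset_add_mset_left empty_neutral(1))
    then have P2: "P = [:- x, 1:] * ([:- x, 1:] * (\<Prod>x\<in>#C. [:- x, 1:]))"
      using A by simp
    have "poly P x = 0" unfolding P2 by simp
    have "poly (pderiv P) x = 0" unfolding P2 pderiv_mult by simp
    then have "of_nat m * x ^ (m - 1) = 0" by (simp add: P_def pderiv_diff pderiv_monom poly_monom pderiv_1)
    then have "x = 0" using of_nat_neq_0[OF assms] by simp
    then show False using \<open>poly P x = 0\<close> assms by (simp add: P_def poly_monom power_0_left)
  qed
  moreover have "set_mset A = mu m"
    unfolding mu A(2) by (auto simp: poly_prod_mset prod_mset_zero_iff)
  ultimately have "A = mset_set (mu m)"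
    using \<open>finite (mu m)\<close> by (intro multiset_eqI)
      (metis One_nat_def count_mset_set(1) count_mset_set(3) le_Suc_eq count_inI le_zero_eq not_in_iff)
  then show "card (mu m) = m" using A(1) by simp
qed

text \<open>Reduction is injective on the \<open>m\<close> roots of unity upstairs, and there are at most \<open>m\<close> downstairs. So all of
them lift, and \<open>X\<^sup>m - 1\<close> splits over the residue field.\<close>

lemma roots_of_unity_residue_field:
  assumes "m > 0" "coprime p m"
  shows "bij_betw red (mu m) {x. x ^ m = 1}"
    and "(Polynomial.monom 1 m - 1 :: 'f poly) = (\<Prod>x | x ^ m = 1. [:- x, 1:])"
proof -
  define P where "P = (Polynomial.monom 1 m - 1 :: 'f poly)"
  have deg: "degree P = m"
    unfolding P_def using assms by (intro antisym degree_le le_degree) (auto simp: coeff_1)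
  then have P0: "P \<noteq> 0" using assms by auto
  have lc: "lead_coeff P = 1"
    unfolding deg using assms by (simp add: P_def coeff_1)
  have roots: "{x. poly P x = 0} = {x. x ^ m = 1}"
    by (simp add: P_def poly_monom)
  have fin: "finite {x :: 'f. x ^ m = 1}"
    using poly_roots_finite[OF P0] roots by simp
  have inj: "inj_on red (mu m)"
    using red_eq_imp_eq[OF assms] by (intro inj_onI) (auto simp: mu_def)
  have sub: "red ` mu m \<subseteq> {x. x ^ m = 1}"
    using mu_subset[OF assms(1)] by (auto simp: mu_def red_hom simp flip: red_power)
  have "card {x :: 'f. x ^ m = 1} \<le> m"
    using card_poly_roots_bound[OF P0] deg roots by simp
  moreover have "card (red ` mu m) = m"
    using card_image[OF inj] card_mu(2)[OF assms(1)] by simp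
  ultimately have eq: "red ` mu m = {x. x ^ m = 1}"
    using card_subset_eq[OF fin sub] card_mono[OF fin sub] by simp
  then show "bij_betw red (mu m) {x. x ^ m = 1}"
    using inj by (simp add: bij_betw_def)
  have cardf: "card {x :: 'f. x ^ m = 1} = m"
    using eq \<open>card (red ` mu m) = m\<close> by simp
  have deg': "degree (\<Prod>x | x ^ m = 1. [:- x, 1 :: 'f:]) = m"
    using cardf by (simp add: degree_prod_sum_eq)
  show "(Polynomial.monom 1 m - 1 :: 'f poly) = (\<Prod>x | x ^ m = 1. [:- x, 1:])"
    unfolding P_def[symmetric]
  proof (rule poly_eqI_degree_lead_coeff[where A = "{x. x ^ m = 1}" and n = m])
    have "lead_coeff (\<Prod>x | x ^ m = 1. [:- x, 1 :: 'f:]) = 1"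
      by (simp add: lead_coeff_prod)
    then show "poly.coeff P m = poly.coeff (\<Prod>x | x ^ m = 1. [:- x, 1:]) m"
      using lc deg deg' by simp
    show "poly P x = poly (\<Prod>x | x ^ m = 1. [:- x, 1:]) x" if "x \<in> {x. x ^ m = 1}" for x
    proof -
      have "poly (\<Prod>x | x ^ m = 1. [:- x, 1:]) x = 0"
        unfolding poly_prod using that fin by (intro prod_zero) auto
      then show ?thesis using that roots by auto
    qed
  qed (use deg deg' cardf in auto)
qed

abbreviation tch :: "'f \<Rightarrow> 'k" where "tch \<equiv> teich p \<iota> red"

lemma teich_red:
  assumes "\<zeta> ^ m = 1" "m > 0" "coprime p m"
  shows "tch (red \<zeta>) = \<zeta>"
  unfolding teich_def
proof (rule the_equality)
  show "\<zeta> \<in> \<O> \<and> red \<zeta> = red \<zeta> \<and> (\<exists>m>0. coprime p m \<and> \<zeta> ^ m = 1)"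
    using assms mu_subset[of m] by (auto simp: mu_def)
  fix \<xi> assume "\<xi> \<in> \<O> \<and> red \<xi> = red \<zeta> \<and> (\<exists>m>0. coprime p m \<and> \<xi> ^ m = 1)"
  then obtain l where l: "l > 0" "coprime p l" "\<xi> ^ l = 1" "red \<xi> = red \<zeta>" by blast
  show "\<xi> = \<zeta>"
  proof (rule red_eq_imp_eq[of "m * l"])
    show "\<xi> ^ (m * l) = 1" using l by (metis mult.commute power_mult power_one)
    show "\<zeta> ^ (m * l) = 1" using assms by (simp add: power_mult)
  qed (use l assms in auto)
qed

lemma teich_root:
  assumes "x ^ m = 1" "m > 0" "coprime p m"
  shows "tch x ^ m = 1" "red (tch x) = x" "tch x \<in> \<O>"
proof -
  obtain \<zeta> where "\<zeta> \<in> mu m" "x = red \<zeta>"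
    using roots_of_unity_residue_field(1)[OF assms(2,3)] assms(1) unfolding bij_betw_def by blast
  then show "tch x ^ m = 1" "red (tch x) = x" "tch x \<in> \<O>"
    using teich_red[of \<zeta> m] assms mu_subset[of m] by (auto simp: mu_def)
qed

lemma teich_mult:
  assumes "x ^ m = 1" "y ^ m = 1" "m > 0" "coprime p m"
  shows "tch (x * y) = tch x * tch y"
  using teich_root[OF assms(1,3,4)] teich_root[OF assms(2,3,4)]
    teich_red[of "tch x * tch y" m] assms(3,4)
  by (simp add: power_mult_distrib red_hom)

lemma teich_power:
  assumes "x ^ m = 1" "m > 0" "coprime p m"
  shows "tch (x ^ j) = tch x ^ j"
proof -
  have "(tch x ^ j) ^ m = 1"
    using teich_root(1)[OF assms] by (metis mult.commute power_mult power_one)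
  then show ?thesis
    using teich_root[OF assms] teich_red[of "tch x ^ j" m] assms(2,3) by (simp add: red_power)
qed

end

section \<open>Brauer characters of representations\<close>

locale brauer_setup = padic_setup p \<iota> red + group G
  for p :: nat and \<iota> :: "(nat \<Rightarrow> int) \<Rightarrow> 'k::alg_closed_field" and red :: "'k \<Rightarrow> 'f::field"
    and G :: "('g, 'b) monoid_scheme" (structure) +
  assumes fin: "finite (carrier G)"
begin

abbreviation Gp :: "'g set" where "Gp \<equiv> p_regular p G"
abbreviation \<phi> :: "('g \<Rightarrow> 'f mat) \<Rightarrow> 'g \<Rightarrow> 'k" where "\<phi> \<equiv> brauer_char p \<iota> red G"
abbreviation RF :: "('g \<Rightarrow> 'k) ring" where "RF \<equiv> brauer_ring p \<iota> red G"

lemma p_regularD: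
  assumes "g \<in> Gp"
  shows "g \<in> carrier G" "ord g > 0" "coprime p (ord g)"
  using assms ord_ge_1[OF fin, of g] by (auto simp: p_regular_def)

lemma p_regular_inv [intro]: "g \<in> Gp \<Longrightarrow> inv g \<in> Gp"
  using ord_inv by (auto simp: p_regular_def)

lemma p_regular_pow [intro]:
  assumes "g \<in> Gp"
  shows "g [^] (j :: nat) \<in> Gp"
proof -
  note gD = p_regularD[OF assms]
  have "(g [^] j) [^] ord g = \<one>"
    using gD(1) pow_ord_eq_1[OF gD(1)] by (simp add: nat_pow_pow mult.commute[of j]) (simp flip: nat_pow_pow)
  then have "ord (g [^] j) dvd ord g"
    using gD(1) by (simp add: pow_eq_id)
  then show ?thesis
    using gD coprime_divisors[of p p "ord (g [^] j)" "ord g"] by (simp add: p_regular_def)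
qed

lemma p_regular_one [intro, simp]: "\<one> \<in> Gp"
  by (simp add: p_regular_def)

lemma repD:
  assumes "mat_rep G n \<rho>"
  shows "g \<in> carrier G \<Longrightarrow> \<rho> g \<in> carrier_mat n n"
    "g \<in> carrier G \<Longrightarrow> h \<in> carrier G \<Longrightarrow> \<rho> (g \<otimes> h) = \<rho> g * \<rho> h" "\<rho> \<one> = 1\<^sub>m n"
  using assms by (auto simp: mat_rep_def)

lemma rep_pow:
  assumes "mat_rep G n \<rho>" "g \<in> carrier G"
  shows "\<rho> (g [^] (j :: nat)) = \<rho> g ^\<^sub>m j"
  using repD[OF assms(1)] assms(2) by (induction j) (auto simp: carrier_matD)

text \<open>On a \<open>p\<close>-regular element of order \<open>u\<close> the characteristic polynomial divides a power of \<open>X\<^sup>u - 1\<close>, which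
splits over the residue field.\<close>

lemma rep_spectrum:
  fixes \<rho> :: "'g \<Rightarrow> 'f mat"
  assumes \<rho>: "mat_rep G n \<rho>" and g: "g \<in> Gp"
  obtains B where "B \<in> carrier_mat n n" "upper_triangular B" "similar_mat (\<rho> g) B"
    "\<And>x. x \<in># proots (char_poly (\<rho> g)) \<Longrightarrow> x ^ ord g = 1"
proof -
  note gD = p_regularD[OF g]
  have A: "\<rho> g \<in> carrier_mat n n" using repD[OF \<rho>] gD by simp
  have "\<rho> g ^\<^sub>m ord g = 1\<^sub>m n"
    using rep_pow[OF \<rho> gD(1), of "ord g"] pow_ord_eq_1[OF gD(1)] repD(3)[OF \<rho>] by simp
  from char_poly_dvd_of_pow_eq_one[OF A this]
  have dvd: "char_poly (\<rho> g) dvd (Polynomial.monom 1 (ord g) - 1) ^ n" .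
  obtain as :: "'f list" where as: "set as = {x. x ^ ord g = 1}" "distinct as"
    using finite_distinct_list card_mu(1)[OF gD(2)] roots_of_unity_residue_field(1)[OF gD(2,3)]
    by (metis bij_betw_finite)
  have "(Polynomial.monom 1 (ord g) - 1 :: 'f poly) = (\<Prod>a\<leftarrow>as. [:- a, 1:])"
    unfolding roots_of_unity_residue_field(2)[OF gD(2,3)] as(1)[symmetric]
    by (rule prod.distinct_set_conv_list[OF as(2)])
  then have "(Polynomial.monom 1 (ord g) - 1 :: 'f poly) ^ k = (\<Prod>a\<leftarrow>concat (replicate k as). [:- a, 1:])"
    for k by (induction k) simp_all
  then have "char_poly (\<rho> g) dvd (\<Prod>a\<leftarrow>concat (replicate n as). [:- a, 1:])"
    using dvd by (simp only:)
  moreover have "monic (char_poly (\<rho> g))"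
    using degree_monic_char_poly[OF A] by simp
  ultimately have "\<exists>es. char_poly (\<rho> g) = (\<Prod>a\<leftarrow>es. [:- a, 1:])"
    by (rule monic_dvd_prod_linear)
  then obtain es where "char_poly (\<rho> g) = (\<Prod>a\<leftarrow>es. [:- a, 1:])" ..
  from similar_upper_triangular[OF A this] obtain B
    where B: "B \<in> carrier_mat n n" "upper_triangular B" "similar_mat (\<rho> g) B" by blast
  show ?thesis
  proof (rule that[OF B])
    fix x assume "x \<in># proots (char_poly (\<rho> g))"
    moreover have "char_poly (\<rho> g) \<noteq> 0"
      using degree_monic_char_poly[OF A] by auto
    ultimately have "poly (char_poly (\<rho> g)) x = 0" by simp
    moreover obtain q where "(Polynomial.monom 1 (ord g) - 1) ^ n = char_poly (\<rho> g) * q"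
      using dvd by (auto simp only: dvd_def)
    ultimately have "poly ((Polynomial.monom 1 (ord g) - 1) ^ n) x = 0"
      by (simp only: poly_mult mult_zero_left)
    then show "x ^ ord g = 1" by (simp add: poly_power poly_monom)
  qed
qed

text \<open>The eigenvalues are the diagonal entries of any triangular form; this is how the values on powers and on
Kronecker products are computed.\<close>

lemma brauer_char_eq:
  assumes "h \<in> Gp" "similar_mat (\<rho> h) B" "B \<in> carrier_mat n n" "upper_triangular B"
  shows "\<phi> \<rho> h = (\<Sum>x\<in>#mset (diag_mat B). tch x)"
  using assms proots_char_poly_upper_triangular[of B n] char_poly_similar[of "\<rho> h" B]
  by (simp add: brauer_char_def)

lemma brauer_char_pow:
  assumes \<rho>: "mat_rep G n \<rho>" and g: "g \<in> Gp"
  shows "\<phi> \<rho> (g [^] (j :: nat)) = (\<Sum>x\<in>#proots (char_poly (\<rho> g)). tch x ^ j)"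
proof -
  note gD = p_regularD[OF g]
  obtain B where B: "B \<in> carrier_mat n n" "upper_triangular B" "similar_mat (\<rho> g) B"
    and root: "\<And>x. x \<in># proots (char_poly (\<rho> g)) \<Longrightarrow> x ^ ord g = 1"
    using rep_spectrum[OF \<rho> g] by metis
  have spec: "proots (char_poly (\<rho> g)) = mset (diag_mat B)"
    using proots_char_poly_upper_triangular[OF B(1,2)] char_poly_similar[OF B(3)] by simp
  have "similar_mat (\<rho> (g [^] j)) (B ^\<^sub>m j)"
    unfolding rep_pow[OF \<rho> gD(1)] using B(3) similar_mat_wit_pow unfolding similar_mat_def by blast
  then have "\<phi> \<rho> (g [^] j) = (\<Sum>x\<in>#mset (diag_mat (B ^\<^sub>m j)). tch x)"
    using B g upper_triangular_pow_diag[OF B(1,2), of j] by (intro brauer_char_eq) auto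
  also have "\<dots> = (\<Sum>x\<in>#mset (diag_mat B). tch (x ^ j))"
    using upper_triangular_pow_diag[OF B(1,2), of j] by (simp add: multiset.map_comp o_def)
  also have "\<dots> = (\<Sum>x\<in>#mset (diag_mat B). tch x ^ j)"
    using root gD unfolding spec
    by (intro arg_cong[of _ _ sum_mset] image_mset_cong) (auto intro: teich_power[of _ "ord g"])
  finally show ?thesis unfolding spec .
qed

lemma det_rep:
  fixes \<rho> :: "'g \<Rightarrow> 'f mat"
  assumes \<rho>: "mat_rep G n \<rho>" and g: "g \<in> Gp"
  shows "det (\<rho> g) = (\<Prod>x\<in>#proots (char_poly (\<rho> g)). x)"
proof -
  obtain B where B: "B \<in> carrier_mat n n" "upper_triangular B" "similar_mat (\<rho> g) B"
    using rep_spectrum[OF \<rho> g] by metis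
  have "proots (char_poly (\<rho> g)) = mset (diag_mat B)"
    using proots_char_poly_upper_triangular[OF B(1,2)] char_poly_similar[OF B(3)] by simp
  then show ?thesis
    using det_similar[OF B(3)] det_upper_triangular[OF B(2,1)] by (simp add: prod_mset_prod_list)
qed

lemma mat_rep_kron:
  assumes "mat_rep G n \<rho>" "mat_rep G m \<sigma>"
  shows "mat_rep G (n * m) (\<lambda>g. kron (\<rho> g) (\<sigma> g))"
  unfolding mat_rep_def
proof (intro conjI ballI)
  fix g h assume gh: "g \<in> carrier G" "h \<in> carrier G"
  note c = repD(1)[OF assms(1)] repD(1)[OF assms(2)]
  show "kron (\<rho> (g \<otimes> h)) (\<sigma> (g \<otimes> h)) = kron (\<rho> g) (\<sigma> g) * kron (\<rho> h) (\<sigma> h)"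
    using gh c by (simp add: repD(2)[OF assms(1)] repD(2)[OF assms(2)] kron_mult[of _ n n _ m m _ n _ m])
qed (use repD[OF assms(1)] repD[OF assms(2)] in \<open>auto simp: kron_one\<close>)

lemma brauer_char_kron:
  assumes \<rho>: "mat_rep G n \<rho>" and \<sigma>: "mat_rep G m \<sigma>" and g: "g \<in> Gp"
  shows "\<phi> (\<lambda>g. kron (\<rho> g) (\<sigma> g)) g = \<phi> \<rho> g * \<phi> \<sigma> g"
proof -
  note gD = p_regularD[OF g]
  obtain B where B: "B \<in> carrier_mat n n" "upper_triangular B" "similar_mat (\<rho> g) B"
    and rootB: "\<And>x. x \<in># proots (char_poly (\<rho> g)) \<Longrightarrow> x ^ ord g = 1"
    using rep_spectrum[OF \<rho> g] by metis
  obtain C where C: "C \<in> carrier_mat m m" "upper_triangular C" "similar_mat (\<sigma> g) C"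
    and rootC: "\<And>x. x \<in># proots (char_poly (\<sigma> g)) \<Longrightarrow> x ^ ord g = 1"
    using rep_spectrum[OF \<sigma> g] by metis
  have spec: "proots (char_poly (\<rho> g)) = mset (diag_mat B)" "proots (char_poly (\<sigma> g)) = mset (diag_mat C)"
    using proots_char_poly_upper_triangular[OF B(1,2)] char_poly_similar[OF B(3)]
      proots_char_poly_upper_triangular[OF C(1,2)] char_poly_similar[OF C(3)] by simp_all
  have "similar_mat (kron (\<rho> g) (\<sigma> g)) (kron B C)"
    using B C gD repD[OF \<rho>] repD[OF \<sigma>] by (intro similar_kron[of _ n _ m]) auto
  then have "\<phi> (\<lambda>g. kron (\<rho> g) (\<sigma> g)) g = (\<Sum>x\<in>#mset (diag_mat (kron B C)). tch x)"
    by (rule brauer_char_eq[OF g _ kron_carrier[OF B(1) C(1)] upper_triangular_kron[OF B(1) C(1) B(2) C(2)]])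
  also have "\<dots> = (\<Sum>x\<in>#mset (diag_mat B). \<Sum>y\<in>#mset (diag_mat C). tch (x * y))"
    by (rule sum_diag_kron[OF B(1) C(1)])
  also have "\<dots> = (\<Sum>x\<in>#mset (diag_mat B). \<Sum>y\<in>#mset (diag_mat C). tch x * tch y)"
    using rootB rootC gD unfolding spec
    by (intro arg_cong[of _ _ sum_mset] image_mset_cong) (auto intro: teich_mult[of _ "ord g"])
  also have "\<dots> = \<phi> \<rho> g * \<phi> \<sigma> g"
    unfolding brauer_char_eq[where \<rho> = \<rho>, OF g B(3,1,2)] brauer_char_eq[where \<rho> = \<sigma>, OF g C(3,1,2)]
    by (subst sum_mset_distrib_right, subst sum_mset_distrib_left) (rule refl)
  finally show ?thesis .
qed

lemma mat_rep_dual: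
  assumes \<rho>: "mat_rep G n \<rho>"
  shows "mat_rep G n (dual_rep G \<rho>)"
  unfolding mat_rep_def dual_rep_def
proof (intro conjI ballI)
  fix g h assume gh: "g \<in> carrier G" "h \<in> carrier G"
  note c = repD(1)[OF \<rho> inv_closed]
  show "(\<rho> (inv (g \<otimes> h)))\<^sup>T = (\<rho> (inv g))\<^sup>T * (\<rho> (inv h))\<^sup>T"
    using gh by (simp add: inv_mult_group repD(2)[OF \<rho>] transpose_mult[OF c c])
qed (use repD[OF \<rho>] in simp_all)

lemma brauer_char_dual:
  assumes \<rho>: "mat_rep G n \<rho>" and g: "g \<in> Gp"
  shows "\<phi> (dual_rep G \<rho>) g = \<phi> \<rho> (inv g)"
  using g p_regular_inv[OF g] char_poly_transpose_mat[OF repD(1)[OF \<rho>, of "inv g"]] p_regularD(1)[OF g]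
  by (simp add: brauer_char_def dual_rep_def)

end

section \<open>The ring of virtual Brauer characters and its duality\<close>

context brauer_setup begin

lemma carrier_brauer_ring:
  "carrier RF = {\<lambda>g\<in>Gp. \<Sum>i<k. of_int (c i) * \<phi> (\<rho> i) g
                  | (k::nat) (c :: nat \<Rightarrow> int) \<rho>. \<forall>i<k. \<exists>n. mat_rep G n (\<rho> i)}"
  by (simp add: brauer_ring_def)

lemma brauer_ring_ops:
  "a \<otimes>\<^bsub>RF\<^esub> b = (\<lambda>g\<in>Gp. a g * b g)" "a \<oplus>\<^bsub>RF\<^esub> b = (\<lambda>g\<in>Gp. a g + b g)"
  "\<one>\<^bsub>RF\<^esub> = (\<lambda>g\<in>Gp. 1)" "\<zero>\<^bsub>RF\<^esub> = (\<lambda>g\<in>Gp. 0)"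
  by (simp_all add: brauer_ring_def)

lemma brauer_ring_ext: "a \<in> carrier RF \<Longrightarrow> g \<notin> Gp \<Longrightarrow> a g = undefined"
  unfolding carrier_brauer_ring by auto

lemma brauer_ring_eqI:
  assumes "a \<in> carrier RF" "b \<in> carrier RF" "\<And>g. g \<in> Gp \<Longrightarrow> a g = b g"
  shows "a = b"
  using assms brauer_ring_ext by (metis ext)

lemma brauer_ring_zero: "(\<lambda>g\<in>Gp. 0) \<in> carrier RF"
  unfolding carrier_brauer_ring by (intro CollectI exI[of _ 0] exI[of _ undefined]) simp

lemma brauer_ring_brauer: "mat_rep G n \<rho> \<Longrightarrow> \<phi> \<rho> \<in> carrier RF"
  unfolding carrier_brauer_ring
  by (intro CollectI exI[of _ 1] exI[of _ "\<lambda>_. 1"] exI[of _ "\<lambda>_. \<rho>"]) (auto simp: brauer_char_def)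

lemma brauer_ring_add:
  assumes "a \<in> carrier RF" "b \<in> carrier RF"
  shows "(\<lambda>g\<in>Gp. a g + b g) \<in> carrier RF"
proof -
  obtain k :: nat and c \<rho> where a: "a = (\<lambda>g\<in>Gp. \<Sum>i<k. of_int (c i) * \<phi> (\<rho> i) g)"
    "\<forall>i<k. \<exists>n. mat_rep G n (\<rho> i)"
    using assms(1) unfolding carrier_brauer_ring by blast
  obtain l :: nat and d \<sigma> where b: "b = (\<lambda>g\<in>Gp. \<Sum>i<l. of_int (d i) * \<phi> (\<sigma> i) g)"
    "\<forall>i<l. \<exists>n. mat_rep G n (\<sigma> i)"
    using assms(2) unfolding carrier_brauer_ring by blast
  \<comment> \<open>Concatenation of the two integer combinations.\<close>
  let ?c = "\<lambda>i. if i < k then c i else d (i - k)" and ?\<rho> = "\<lambda>i. if i < k then \<rho> i else \<sigma> (i - k)"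
  have "(\<Sum>i<k + l. of_int (?c i) * \<phi> (?\<rho> i) g) =
        (\<Sum>i<k. of_int (c i) * \<phi> (\<rho> i) g) + (\<Sum>i<l. of_int (d i) * \<phi> (\<sigma> i) g)" for g
    by (induction l) (simp_all add: add.assoc)
  then have "(\<lambda>g\<in>Gp. a g + b g) = (\<lambda>g\<in>Gp. \<Sum>i<k + l. of_int (?c i) * \<phi> (?\<rho> i) g)"
    by (intro restrict_ext) (simp add: a b)
  then show ?thesis
    unfolding carrier_brauer_ring using a(2) b(2)
    by (intro CollectI exI[of _ "k + l"] exI[of _ ?c] exI[of _ ?\<rho>]) auto
qed

lemma brauer_ring_uminus:
  assumes "a \<in> carrier RF"
  shows "(\<lambda>g\<in>Gp. - a g) \<in> carrier RF"
proof -
  obtain k :: nat and c \<rho> where a: "a = (\<lambda>g\<in>Gp. \<Sum>i<k. of_int (c i) * \<phi> (\<rho> i) g)"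
    "\<forall>i<k. \<exists>n. mat_rep G n (\<rho> i)"
    using assms unfolding carrier_brauer_ring by blast
  have "(\<lambda>g\<in>Gp. - a g) = (\<lambda>g\<in>Gp. \<Sum>i<k. of_int (- c i) * \<phi> (\<rho> i) g)"
    by (intro restrict_ext) (simp add: a sum_negf)
  then show ?thesis
    unfolding carrier_brauer_ring using a(2)
    by (intro CollectI exI[of _ k] exI[of _ "\<lambda>i. - c i"] exI[of _ \<rho>]) auto
qed

text \<open>The virtual Brauer characters are the additive group generated by the Brauer characters. This principle
takes the place of the explicit integer combinations in the proofs below.\<close>

lemma brauer_ring_induct [consumes 1, case_names zero brauer add uminus]:
  assumes a: "a \<in> carrier RF"
    and z: "P (\<lambda>g\<in>Gp. 0)"
    and brauer: "\<And>n \<rho>. mat_rep G n \<rho> \<Longrightarrow> P (\<phi> \<rho>)"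
    and add: "\<And>a b. a \<in> carrier RF \<Longrightarrow> b \<in> carrier RF \<Longrightarrow> P a \<Longrightarrow> P b \<Longrightarrow> P (\<lambda>g\<in>Gp. a g + b g)"
    and uminus: "\<And>a. a \<in> carrier RF \<Longrightarrow> P a \<Longrightarrow> P (\<lambda>g\<in>Gp. - a g)"
  shows "P a"
proof -
  have nat_mult: "(\<lambda>g\<in>Gp. of_nat m * \<phi> \<rho> g) \<in> carrier RF \<and> P (\<lambda>g\<in>Gp. of_nat m * \<phi> \<rho> g)"
    if \<rho>: "mat_rep G n \<rho>" for n \<rho> m
  proof (induction m)
    case 0
    have "(\<lambda>g\<in>Gp. of_nat 0 * \<phi> \<rho> g) = (\<lambda>g\<in>Gp. 0)" by (intro restrict_ext) simp
    then show ?case using z brauer_ring_zero by (simp only:)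
  next
    case (Suc m)
    have "(\<lambda>g\<in>Gp. of_nat (Suc m) * \<phi> \<rho> g) = (\<lambda>g\<in>Gp. \<phi> \<rho> g + (\<lambda>g\<in>Gp. of_nat m * \<phi> \<rho> g) g)"
      by (intro restrict_ext) (simp add: algebra_simps)
    moreover note Suc brauer_ring_add[OF brauer_ring_brauer[OF \<rho>]] add[OF brauer_ring_brauer[OF \<rho>] _ brauer[OF \<rho>]]
    ultimately show ?case by (simp only:)
  qed
  have int_mult: "(\<lambda>g\<in>Gp. of_int c * \<phi> \<rho> g) \<in> carrier RF \<and> P (\<lambda>g\<in>Gp. of_int c * \<phi> \<rho> g)"
    if \<rho>: "mat_rep G n \<rho>" for n \<rho> c
  proof (cases "c \<ge> 0")
    case True
    then show ?thesis using nat_mult[OF \<rho>, of "nat c"] by simp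
  next
    case False
    then have "(\<lambda>g\<in>Gp. of_int c * \<phi> \<rho> g) = (\<lambda>g\<in>Gp. - (\<lambda>g\<in>Gp. of_nat (nat (- c)) * \<phi> \<rho> g) g)"
      by (intro restrict_ext) simp
    then show ?thesis
      using nat_mult[OF \<rho>, of "nat (- c)"] uminus brauer_ring_uminus by presburger
  qed
  obtain k :: nat and c \<rho> where a: "a = (\<lambda>g\<in>Gp. \<Sum>i<k. of_int (c i) * \<phi> (\<rho> i) g)"
    "\<forall>i<k. \<exists>n. mat_rep G n (\<rho> i)"
    using a unfolding carrier_brauer_ring by blast
  have "(\<lambda>g\<in>Gp. \<Sum>i<j. of_int (c i) * \<phi> (\<rho> i) g) \<in> carrier RF \<and>
        P (\<lambda>g\<in>Gp. \<Sum>i<j. of_int (c i) * \<phi> (\<rho> i) g)" if "j \<le> k" for j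
    using that
  proof (induction j)
    case 0
    have "(\<lambda>g\<in>Gp. \<Sum>i<0. of_int (c i) * \<phi> (\<rho> i) g) = (\<lambda>g\<in>Gp. 0)" by (intro restrict_ext) simp
    then show ?case using z brauer_ring_zero by (simp only:)
  next
    case (Suc j)
    then obtain n where \<rho>: "mat_rep G n (\<rho> j)" using a(2) by (meson Suc_le_lessD)
    have "(\<lambda>g\<in>Gp. \<Sum>i<Suc j. of_int (c i) * \<phi> (\<rho> i) g) =
      (\<lambda>g\<in>Gp. (\<lambda>g\<in>Gp. \<Sum>i<j. of_int (c i) * \<phi> (\<rho> i) g) g + (\<lambda>g\<in>Gp. of_int (c j) * \<phi> (\<rho> j) g) g)"
      by (intro restrict_ext) simp
    moreover have IH: "(\<lambda>g\<in>Gp. \<Sum>i<j. of_int (c i) * \<phi> (\<rho> i) g) \<in> carrier RF \<and>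
        P (\<lambda>g\<in>Gp. \<Sum>i<j. of_int (c i) * \<phi> (\<rho> i) g)"
      by (rule Suc.IH[OF Suc_leD[OF Suc.prems]])
    moreover note int_mult[OF \<rho>, of "c j"]
    ultimately show ?case
      using brauer_ring_add add by (simp only:)
  qed
  then show ?thesis using a(1) by simp
qed

lemma brauer_ring_mult:
  assumes "a \<in> carrier RF" "b \<in> carrier RF"
  shows "(\<lambda>g\<in>Gp. a g * b g) \<in> carrier RF"
  using assms
proof (induction a arbitrary: b rule: brauer_ring_induct)
  case zero
  have "(\<lambda>g\<in>Gp. (\<lambda>g\<in>Gp. 0) g * b g) = (\<lambda>g\<in>Gp. 0)" by (intro restrict_ext) simp
  then show ?case using brauer_ring_zero by (simp only:)
next
  case (brauer n \<rho>)
  from brauer.prems show ?case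
  proof (induction b rule: brauer_ring_induct)
    case zero
    have "(\<lambda>g\<in>Gp. \<phi> \<rho> g * (\<lambda>g\<in>Gp. 0) g) = (\<lambda>g\<in>Gp. 0)" by (intro restrict_ext) simp
    then show ?case using brauer_ring_zero by (simp only:)
  next
    case (brauer m \<sigma>)
    have "(\<lambda>g\<in>Gp. \<phi> \<rho> g * \<phi> \<sigma> g) = \<phi> (\<lambda>g. kron (\<rho> g) (\<sigma> g))"
      using brauer_char_kron[OF \<open>mat_rep G n \<rho>\<close> brauer]
      by (intro ext) (auto simp: restrict_def brauer_char_def[of _ _ _ _ "\<lambda>g. kron (\<rho> g) (\<sigma> g)"])
    then show ?case
      using brauer_ring_brauer[OF mat_rep_kron[OF \<open>mat_rep G n \<rho>\<close> brauer]] by simp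
  next
    case (add b c)
    have "(\<lambda>g\<in>Gp. \<phi> \<rho> g * (\<lambda>g\<in>Gp. b g + c g) g) =
        (\<lambda>g\<in>Gp. (\<lambda>g\<in>Gp. \<phi> \<rho> g * b g) g + (\<lambda>g\<in>Gp. \<phi> \<rho> g * c g) g)"
      by (intro restrict_ext) (simp add: algebra_simps)
    then show ?case using brauer_ring_add add by (simp only:)
  next
    case (uminus b)
    have "(\<lambda>g\<in>Gp. \<phi> \<rho> g * (\<lambda>g\<in>Gp. - b g) g) = (\<lambda>g\<in>Gp. - (\<lambda>g\<in>Gp. \<phi> \<rho> g * b g) g)"
      by (intro restrict_ext) simp
    then show ?case using brauer_ring_uminus uminus by (simp only:)
  qed
next
  case (add a c)
  have "(\<lambda>g\<in>Gp. (\<lambda>g\<in>Gp. a g + c g) g * b g) =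
      (\<lambda>g\<in>Gp. (\<lambda>g\<in>Gp. a g * b g) g + (\<lambda>g\<in>Gp. c g * b g) g)"
    by (intro restrict_ext) (simp add: algebra_simps)
  then show ?case using brauer_ring_add add by (simp only:)
next
  case (uminus a)
  have "(\<lambda>g\<in>Gp. (\<lambda>g\<in>Gp. - a g) g * b g) = (\<lambda>g\<in>Gp. - (\<lambda>g\<in>Gp. a g * b g) g)"
    by (intro restrict_ext) simp
  then show ?case using brauer_ring_uminus uminus by (simp only:)
qed

lemma mat_rep_trivial: "mat_rep G 1 (\<lambda>_. 1\<^sub>m 1)"
  by (auto simp: mat_rep_def)

lemma brauer_ring_dual:
  assumes "a \<in> carrier RF"
  shows "(\<lambda>g\<in>Gp. a (inv g)) \<in> carrier RF"
  using assms
proof (induction a rule: brauer_ring_induct)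
  case zero
  have "(\<lambda>g\<in>Gp. (\<lambda>g\<in>Gp. 0 :: 'k) (inv g)) = (\<lambda>g\<in>Gp. 0)" by (intro restrict_ext) auto
  then show ?case using brauer_ring_zero by (simp only:)
next
  case (brauer n \<rho>)
  have "(\<lambda>g\<in>Gp. \<phi> \<rho> (inv g)) = \<phi> (dual_rep G \<rho>)"
    using brauer_char_dual[OF brauer]
    by (intro ext) (auto simp: restrict_def brauer_char_def[of _ _ _ _ "dual_rep G \<rho>"])
  then show ?case using brauer_ring_brauer[OF mat_rep_dual[OF brauer]] by simp
next
  case (add a b)
  have "(\<lambda>g\<in>Gp. (\<lambda>g\<in>Gp. a g + b g) (inv g)) =
      (\<lambda>g\<in>Gp. (\<lambda>g\<in>Gp. a (inv g)) g + (\<lambda>g\<in>Gp. b (inv g)) g)"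
    by (intro restrict_ext) auto
  then show ?case using brauer_ring_add add by (simp only:)
next
  case (uminus a)
  have "(\<lambda>g\<in>Gp. (\<lambda>g\<in>Gp. - a g) (inv g)) = (\<lambda>g\<in>Gp. - (\<lambda>g\<in>Gp. a (inv g)) g)"
    by (intro restrict_ext) auto
  then show ?case using brauer_ring_uminus uminus by (simp only:)
qed

text \<open>Dualising a representation inverts the group element up to a transposition, which preserves the
characteristic polynomial. Hence inversion of the argument has the properties that define duality, and by
additivity it is the only such map.\<close>

lemma duality_eq: "duality p \<iota> red G = (\<lambda>a\<in>carrier RF. \<lambda>g\<in>Gp. a (inv g))" (is "_ = ?D")
  unfolding duality_def
proof (rule the_equality)
  have hom: "?D \<in> Ring.ring_hom RF RF"
  proof (rule Ring.ring_hom_memI)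
    fix a b assume ab: "a \<in> carrier RF" "b \<in> carrier RF"
    show "?D a \<in> carrier RF" using brauer_ring_dual ab by simp
    show "?D (a \<otimes>\<^bsub>RF\<^esub> b) = ?D a \<otimes>\<^bsub>RF\<^esub> ?D b" "?D (a \<oplus>\<^bsub>RF\<^esub> b) = ?D a \<oplus>\<^bsub>RF\<^esub> ?D b"
      using ab brauer_ring_mult[OF ab] brauer_ring_add[OF ab] by (auto simp: brauer_ring_ops intro!: restrict_ext)
  next
    have "(\<lambda>g\<in>Gp. 1) = \<phi> (\<lambda>_. 1\<^sub>m 1)"
    proof
      fix g
      show "(\<lambda>g\<in>Gp. 1) g = \<phi> (\<lambda>_. 1\<^sub>m 1) g"
      proof (cases "g \<in> Gp")
        case True
        then have "\<phi> (\<lambda>_. 1\<^sub>m 1) g = (\<Sum>x\<in>#mset (diag_mat (1\<^sub>m 1)). tch x)"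
          by (intro brauer_char_eq similar_mat_refl) auto
        then show ?thesis
          using True teich_red[of 1 1] by (simp add: diag_mat_def red_hom)
      qed (simp add: brauer_char_def)
    qed
    then have "(\<lambda>g\<in>Gp. 1) \<in> carrier RF" using brauer_ring_brauer[OF mat_rep_trivial] by simp
    then show "?D \<one>\<^bsub>RF\<^esub> = \<one>\<^bsub>RF\<^esub>"
      by (auto simp: brauer_ring_ops intro!: restrict_ext)
  qed
  have invol: "?D (?D a) = a" if "a \<in> carrier RF" for a
    using that brauer_ring_dual[OF that] brauer_ring_dual[OF brauer_ring_dual[OF that]] p_regularD(1)
    by (intro brauer_ring_eqI) auto
  have "bij_betw ?D (carrier RF) (carrier RF)"
    by (rule bij_betw_byWitness[of _ ?D]) (use invol brauer_ring_dual in auto)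
  then show "?D \<in> ring_iso RF RF \<and> ?D \<in> extensional (carrier RF) \<and>
      (\<forall>n \<rho>. mat_rep G n \<rho> \<longrightarrow> ?D (\<phi> \<rho>) = \<phi> (dual_rep G \<rho>))"
    using hom brauer_ring_brauer brauer_char_dual
    by (auto simp: ring_iso_def brauer_char_def[of _ _ _ _ "dual_rep G _"] intro!: restrict_ext)
  fix D assume D: "D \<in> ring_iso RF RF \<and> D \<in> extensional (carrier RF) \<and>
      (\<forall>n \<rho>. mat_rep G n \<rho> \<longrightarrow> D (\<phi> \<rho>) = \<phi> (dual_rep G \<rho>))"
  then have homD: "D \<in> Ring.ring_hom RF RF" by (simp add: ring_iso_def)
  have Dc: "D a \<in> carrier RF" if "a \<in> carrier RF" for a
    using Ring.ring_hom_closed[OF homD that] .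
  have Dadd: "D (\<lambda>g\<in>Gp. a g + b g) = (\<lambda>g\<in>Gp. D a g + D b g)" if "a \<in> carrier RF" "b \<in> carrier RF" for a b
    using Ring.ring_hom_add[OF homD that] by (simp add: brauer_ring_ops)
  have D0: "D (\<lambda>g\<in>Gp. 0) g = 0" if "g \<in> Gp" for g
  proof -
    have "(\<lambda>g\<in>Gp. (\<lambda>g\<in>Gp. 0) g + (\<lambda>g\<in>Gp. 0) g) = (\<lambda>g\<in>Gp. 0 :: 'k)"
      by (intro restrict_ext) simp
    then have "D (\<lambda>g\<in>Gp. 0) g = D (\<lambda>g\<in>Gp. 0) g + D (\<lambda>g\<in>Gp. 0) g"
      using fun_cong[OF Dadd[OF brauer_ring_zero brauer_ring_zero], of g] that by simp
    then show ?thesis by (simp only: add_cancel_right_right)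
  qed
  have main: "D a g = a (inv g)" if "a \<in> carrier RF" "g \<in> Gp" for a g
    using that(1)
  proof (induction a rule: brauer_ring_induct)
    case zero
    have "(\<lambda>g\<in>Gp. 0 :: 'k) (inv g) = 0" using p_regular_inv[OF that(2)] by simp
    then show ?case using D0[OF that(2)] by (simp only:)
  next
    case (brauer n \<rho>)
    then show ?case using D brauer_char_dual that(2) by simp
  next
    case (add a b)
    have "(\<lambda>g\<in>Gp. D a g + D b g) g = D a g + D b g"
      "(\<lambda>g\<in>Gp. a g + b g) (inv g) = a (inv g) + b (inv g)"
      using that(2) p_regular_inv by simp_all
    then show ?case by (simp only: Dadd[OF add(1,2)] add.IH)
  next
    case (uminus a)
    have "(\<lambda>g\<in>Gp. a g + (\<lambda>g\<in>Gp. - a g) g) = (\<lambda>g\<in>Gp. 0)"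
      by (intro restrict_ext) simp
    then have "D a g + D (\<lambda>g\<in>Gp. - a g) g = 0"
      using fun_cong[OF Dadd[OF uminus(1) brauer_ring_uminus[OF uminus(1)]], of g] D0 that(2) by simp
    then have "D (\<lambda>g\<in>Gp. - a g) g = - a (inv g)"
      using uminus.IH by (metis add.commute eq_neg_iff_add_eq_0)
    moreover have "(\<lambda>g\<in>Gp. - a g) (inv g) = - a (inv g)"
      using that(2) p_regular_inv by simp
    ultimately show ?case by (simp only:)
  qed
  show "D = ?D"
  proof
    fix a
    show "D a = ?D a"
    proof (cases "a \<in> carrier RF")
      case True
      then show ?thesis using main brauer_ring_dual Dc by (intro brauer_ring_eqI) auto
    next
      case False
      then show ?thesis using D by (auto simp: extensional_def)
    qed
  qed
qed

text \<open>The values lie in a field, so inverses in the ring are pointwise; and an \<open>a\<close> with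
\<open>a(g) a(g\<inverse>) = 1\<close> is a unit because the dual of \<open>a\<close> is again a virtual Brauer character.\<close>

lemma orthogonal_units_eq:
  "orthogonal_units p \<iota> red G = {a \<in> carrier RF. \<forall>g\<in>Gp. a g * a (inv g) = 1}"
proof -
  have inv_eq: "inv\<^bsub>RF\<^esub> a = b"
    if "a \<in> carrier RF" "b \<in> carrier RF" "\<And>g. g \<in> Gp \<Longrightarrow> a g * b g = 1" for a b
    unfolding m_inv_def
  proof (rule the_equality)
    show "b \<in> carrier RF \<and> a \<otimes>\<^bsub>RF\<^esub> b = \<one>\<^bsub>RF\<^esub> \<and> b \<otimes>\<^bsub>RF\<^esub> a = \<one>\<^bsub>RF\<^esub>"
      using that by (auto simp: brauer_ring_ops mult.commute intro!: restrict_ext)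
    fix c assume c: "c \<in> carrier RF \<and> a \<otimes>\<^bsub>RF\<^esub> c = \<one>\<^bsub>RF\<^esub> \<and> c \<otimes>\<^bsub>RF\<^esub> a = \<one>\<^bsub>RF\<^esub>"
    have "c g = b g" if "g \<in> Gp" for g
    proof -
      have "a g * c g = 1" using c that by (auto simp: brauer_ring_ops dest!: fun_cong[of _ _ g])
      then show ?thesis
        using \<open>\<And>g. g \<in> Gp \<Longrightarrow> a g * b g = 1\<close>[OF that]
        by (metis mult_cancel_left mult_zero_left zero_neq_one)
    qed
    then show "c = b" using c that by (intro brauer_ring_eqI) auto
  qed
  show ?thesis
  proof (intro equalityI subsetI)
    fix a assume "a \<in> orthogonal_units p \<iota> red G"
    then have a: "a \<in> Units RF" "inv\<^bsub>RF\<^esub> a = duality p \<iota> red G a"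
      by (auto simp: orthogonal_units_def)
    then obtain b where b: "a \<in> carrier RF" "b \<in> carrier RF" "a \<otimes>\<^bsub>RF\<^esub> b = \<one>\<^bsub>RF\<^esub>"
      by (auto simp: Units_def)
    have ab: "a g * b g = 1" if "g \<in> Gp" for g
      using fun_cong[OF b(3), of g] that by (simp add: brauer_ring_ops)
    then have "b = (\<lambda>g\<in>Gp. a (inv g))"
      using inv_eq[OF b(1,2)] a(2) b(1) by (simp add: duality_eq)
    then show "a \<in> {a \<in> carrier RF. \<forall>g\<in>Gp. a g * a (inv g) = 1}"
      using b(1) ab by auto
  next
    fix a assume "a \<in> {a \<in> carrier RF. \<forall>g\<in>Gp. a g * a (inv g) = 1}"
    then have a: "a \<in> carrier RF" "\<And>g. g \<in> Gp \<Longrightarrow> a g * a (inv g) = 1" by auto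
    have "inv\<^bsub>RF\<^esub> a = (\<lambda>g\<in>Gp. a (inv g))"
      using a brauer_ring_dual by (intro inv_eq) auto
    moreover have "a \<in> Units RF"
      using a brauer_ring_dual[OF a(1)]
      by (auto simp: Units_def brauer_ring_ops mult.commute intro!: bexI[of _ "\<lambda>g\<in>Gp. a (inv g)"] restrict_ext)
    ultimately show "a \<in> orthogonal_units p \<iota> red G"
      using a(1) by (simp add: orthogonal_units_def duality_eq)
  qed
qed

end

section \<open>The determinant of a virtual Brauer character\<close>

lemma sum_mset_eq_sum_count:
  assumes "finite S" "set_mset M \<subseteq> S"
  shows "(\<Sum>x\<in>#M. f x) = (\<Sum>x\<in>S. of_nat (count M x) * (f x :: 'b :: comm_semiring_1))"
  using assms(2)
proof (induction M)
  case (add a M)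
  have "(\<Sum>x\<in>S. of_nat (count (add_mset a M) x) * f x) =
        (\<Sum>x\<in>S. (if x = a then f a else 0) + of_nat (count M x) * f x)"
    by (intro sum.cong) (auto simp: algebra_simps)
  also have "\<dots> = f a + (\<Sum>x\<in>#M. f x)"
    using add assms(1) by (simp add: sum.distrib)
  finally show ?case by simp
qed simp

lemma prod_mset_eq_prod_count:
  assumes "finite S" "set_mset M \<subseteq> S"
  shows "(\<Prod>x\<in>#M. x) = (\<Prod>x\<in>S. (x :: 'b :: comm_semiring_1) ^ count M x)"
  using assms(2)
proof (induction M)
  case (add a M)
  have "(\<Prod>x\<in>S. x ^ count (add_mset a M) x) =
        (\<Prod>x\<in>S. (if x = a then a else 1) * x ^ count M x)"
    by (intro prod.cong) auto
  also have "\<dots> = a * (\<Prod>x\<in>#M. x)"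
    using add assms(1) by (simp add: prod.distrib)
  finally show ?case by simp
qed simp

context brauer_setup begin

text \<open>The determinant of a virtual module, as a relation: \<open>\<delta>\<close> is multiplicative on \<open>G\<close>, and on a \<open>p\<close>-regular
element its value is determined by the same eigenvalue multiplicities \<open>n\<close> (now possibly negative) that give
the values of \<open>a\<close> on all powers of that element.\<close>

definition virtual_det :: "('g \<Rightarrow> 'k) \<Rightarrow> ('g \<Rightarrow> 'f) \<Rightarrow> bool" where
  "virtual_det a \<delta> \<longleftrightarrow>
     (\<forall>g\<in>carrier G. \<delta> g \<noteq> 0) \<and>
     (\<forall>g\<in>carrier G. \<forall>h\<in>carrier G. \<delta> (g \<otimes> h) = \<delta> g * \<delta> h) \<and>
     (\<forall>g\<in>Gp. \<exists>n :: 'k \<Rightarrow> int.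
        (\<forall>j :: nat. a (g [^] j) = (\<Sum>\<zeta>\<in>mu (ord g). of_int (n \<zeta>) * \<zeta> ^ j)) \<and>
        \<delta> g = (\<Prod>\<zeta>\<in>mu (ord g). red \<zeta> powi n \<zeta>))"

lemma of_int_neq_0:
  assumes "z \<noteq> 0"
  shows "(of_int z :: 'k) \<noteq> 0"
proof (cases "z > 0")
  case True
  then show ?thesis using of_nat_neq_0[of "nat z"] by simp
next
  case False
  then have "(of_int z :: 'k) = - of_nat (nat (- z))" by simp
  then show ?thesis using of_nat_neq_0[of "nat (- z)"] False assms by simp
qed

lemma red_mu_neq_0: "m > 0 \<Longrightarrow> \<zeta> \<in> mu m \<Longrightarrow> red \<zeta> \<noteq> 0"
  using mu_subset[of m] red_power[of \<zeta> m] red_hom(3) by (auto simp: mu_def power_0_left)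

lemma virtual_det_brauer_char:
  assumes \<rho>: "mat_rep G n \<rho>"
  shows "virtual_det (\<phi> \<rho>) (\<lambda>g. det (\<rho> g))"
proof -
  have mult: "det (\<rho> (g \<otimes> h)) = det (\<rho> g) * det (\<rho> h)" if "g \<in> carrier G" "h \<in> carrier G" for g h
    using repD[OF \<rho>] that by (simp add: det_mult[of _ n])
  have "det (\<rho> g) \<noteq> 0" if "g \<in> carrier G" for g
    using mult[OF that inv_closed[OF that]] that repD(3)[OF \<rho>] by auto
  moreover have "\<exists>m :: 'k \<Rightarrow> int.
        (\<forall>j :: nat. \<phi> \<rho> (g [^] j) = (\<Sum>\<zeta>\<in>mu (ord g). of_int (m \<zeta>) * \<zeta> ^ j)) \<and>
        det (\<rho> g) = (\<Prod>\<zeta>\<in>mu (ord g). red \<zeta> powi m \<zeta>)" if g: "g \<in> Gp" for g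
  proof -
    note gD = p_regularD[OF g]
    let ?M = "proots (char_poly (\<rho> g))" and ?S = "{x :: 'f. x ^ ord g = 1}"
    have sub: "set_mset ?M \<subseteq> ?S"
      using rep_spectrum[OF \<rho> g] by blast
    note bij = roots_of_unity_residue_field(1)[OF gD(2,3)]
    have fin: "finite ?S" using bij card_mu(1)[OF gD(2)] bij_betw_finite by blast
    have "\<phi> \<rho> (g [^] j) = (\<Sum>\<zeta>\<in>mu (ord g). of_int (int (count ?M (red \<zeta>))) * \<zeta> ^ j)" for j :: nat
    proof -
      have "\<phi> \<rho> (g [^] j) = (\<Sum>x\<in>?S. of_nat (count ?M x) * tch x ^ j)"
        unfolding brauer_char_pow[OF \<rho> g] by (rule sum_mset_eq_sum_count[OF fin sub])
      also have "\<dots> = (\<Sum>\<zeta>\<in>mu (ord g). of_nat (count ?M (red \<zeta>)) * tch (red \<zeta>) ^ j)"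
        by (rule sum.reindex_bij_betw[OF bij, symmetric])
      also have "\<dots> = (\<Sum>\<zeta>\<in>mu (ord g). of_int (int (count ?M (red \<zeta>))) * \<zeta> ^ j)"
        using gD by (intro sum.cong) (auto simp: mu_def teich_red)
      finally show ?thesis .
    qed
    moreover have "det (\<rho> g) = (\<Prod>\<zeta>\<in>mu (ord g). red \<zeta> powi int (count ?M (red \<zeta>)))"
    proof -
      have "det (\<rho> g) = (\<Prod>x\<in>?S. x ^ count ?M x)"
        unfolding det_rep[OF \<rho> g] by (rule prod_mset_eq_prod_count[OF fin sub])
      also have "\<dots> = (\<Prod>\<zeta>\<in>mu (ord g). red \<zeta> ^ count ?M (red \<zeta>))"
        by (rule prod.reindex_bij_betw[OF bij, symmetric])
      finally show ?thesis by simp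
    qed
    ultimately show ?thesis by (intro exI[of _ "\<lambda>\<zeta>. int (count ?M (red \<zeta>))"]) blast
  qed
  ultimately show ?thesis using mult by (simp add: virtual_det_def)
qed

text \<open>The multiplicities add up, and the determinants multiply accordingly.\<close>

lemma ex_virtual_det:
  assumes "a \<in> carrier RF"
  shows "\<exists>\<delta>. virtual_det a \<delta>"
  using assms
proof (induction a rule: brauer_ring_induct)
  case zero
  have "virtual_det (\<lambda>g\<in>Gp. 0) (\<lambda>_. 1)"
    by (auto simp: virtual_det_def intro!: exI[of _ "\<lambda>_. 0"])
  then show ?case by blast
next
  case (brauer n \<rho>)
  then show ?case using virtual_det_brauer_char by blast
next
  case (add a b)
  then obtain \<delta> \<epsilon> where t: "virtual_det a \<delta>" "virtual_det b \<epsilon>" by blast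
  have "\<exists>n :: 'k \<Rightarrow> int.
        (\<forall>j :: nat. (\<lambda>g\<in>Gp. a g + b g) (g [^] j) = (\<Sum>\<zeta>\<in>mu (ord g). of_int (n \<zeta>) * \<zeta> ^ j)) \<and>
        \<delta> g * \<epsilon> g = (\<Prod>\<zeta>\<in>mu (ord g). red \<zeta> powi n \<zeta>)" if g: "g \<in> Gp" for g
  proof -
    obtain n where n: "\<forall>j :: nat. a (g [^] j) = (\<Sum>\<zeta>\<in>mu (ord g). of_int (n \<zeta>) * \<zeta> ^ j)"
      "\<delta> g = (\<Prod>\<zeta>\<in>mu (ord g). red \<zeta> powi n \<zeta>)"
      using t(1) g unfolding virtual_det_def by blast
    obtain m where m: "\<forall>j :: nat. b (g [^] j) = (\<Sum>\<zeta>\<in>mu (ord g). of_int (m \<zeta>) * \<zeta> ^ j)"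
      "\<epsilon> g = (\<Prod>\<zeta>\<in>mu (ord g). red \<zeta> powi m \<zeta>)"
      using t(2) g unfolding virtual_det_def by blast
    have "\<delta> g * \<epsilon> g = (\<Prod>\<zeta>\<in>mu (ord g). red \<zeta> powi (n \<zeta> + m \<zeta>))"
      unfolding n m prod.distrib[symmetric]
      using p_regularD(2)[OF g] by (intro prod.cong) (auto simp: power_int_add red_mu_neq_0)
    then show ?thesis
      using p_regular_pow[OF g] n(1) m(1)
      by (intro exI[of _ "\<lambda>\<zeta>. n \<zeta> + m \<zeta>"]) (simp add: sum.distrib ring_distribs)
  qed
  then have "virtual_det (\<lambda>g\<in>Gp. a g + b g) (\<lambda>g. \<delta> g * \<epsilon> g)"
    using t unfolding virtual_det_def by (auto simp: mult_ac)
  then show ?case by blast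
next
  case (uminus a)
  then obtain \<delta> where t: "virtual_det a \<delta>" by blast
  have "\<exists>n :: 'k \<Rightarrow> int.
        (\<forall>j :: nat. (\<lambda>g\<in>Gp. - a g) (g [^] j) = (\<Sum>\<zeta>\<in>mu (ord g). of_int (n \<zeta>) * \<zeta> ^ j)) \<and>
        inverse (\<delta> g) = (\<Prod>\<zeta>\<in>mu (ord g). red \<zeta> powi n \<zeta>)" if g: "g \<in> Gp" for g
  proof -
    obtain n where n: "\<forall>j :: nat. a (g [^] j) = (\<Sum>\<zeta>\<in>mu (ord g). of_int (n \<zeta>) * \<zeta> ^ j)"
      "\<delta> g = (\<Prod>\<zeta>\<in>mu (ord g). red \<zeta> powi n \<zeta>)"
      using t g unfolding virtual_det_def by blast
    have "inverse (\<delta> g) = (\<Prod>\<zeta>\<in>mu (ord g). red \<zeta> powi (- n \<zeta>))"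
      unfolding n by (simp add: power_int_minus prod_inversef[symmetric] o_def)
    then show ?thesis
      using p_regular_pow[OF g] n(1) by (intro exI[of _ "\<lambda>\<zeta>. - n \<zeta>"]) (simp add: sum_negf)
  qed
  then have "virtual_det (\<lambda>g\<in>Gp. - a g) (\<lambda>g. inverse (\<delta> g))"
    using t unfolding virtual_det_def by (auto simp: mult_ac)
  then show ?case by blast
qed

end

section \<open>Orthogonal units are linear characters up to sign\<close>

lemma sum_squares_eq_one:
  fixes n :: "'a \<Rightarrow> int"
  assumes "finite S" "(\<Sum>x\<in>S. n x ^ 2) = 1"
  obtains x0 where "x0 \<in> S" "n x0 = 1 \<or> n x0 = - 1" "\<And>x. x \<in> S \<Longrightarrow> x \<noteq> x0 \<Longrightarrow> n x = 0"
proof -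
  obtain x0 where x0: "x0 \<in> S" "n x0 \<noteq> 0"
    using assms by (metis (mono_tags, lifting) power_zero_numeral sum.neutral zero_neq_one)
  have eq: "n x0 ^ 2 + (\<Sum>x\<in>S - {x0}. n x ^ 2) = 1"
    using assms sum.remove[OF assms(1) x0(1), of "\<lambda>x. n x ^ 2"] by simp
  moreover have "n x0 ^ 2 \<ge> 1"
    using x0(2) by (simp add: int_one_le_iff_zero_less)
  moreover have "(\<Sum>x\<in>S - {x0}. n x ^ 2) \<ge> 0"
    by (intro sum_nonneg) simp
  ultimately have "n x0 ^ 2 = 1" "(\<Sum>x\<in>S - {x0}. n x ^ 2) = 0"
    by linarith+
  then show ?thesis
    using that[OF x0(1)] assms(1) by (auto simp: sum_nonneg_eq_0_iff power2_eq_1_iff)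
qed

lemma sum_powers_root_of_unity:
  fixes w :: "'a :: field"
  assumes "w ^ u = 1"
  shows "(\<Sum>j<u. w ^ j) = (if w = 1 then of_nat u else 0)"
  using assms by (simp add: geometric_sum)

context brauer_setup begin

text \<open>Orthogonality of the characters of the cyclic group generated by \<open>g\<close>: averaging \<open>a(g\<^sup>j) a(g\<^sup>-\<^sup>j) = 1\<close> over
\<open>j\<close> leaves \<open>\<Sum>\<^sub>\<zeta> n\<^sub>\<zeta>\<^sup>2 = 1\<close>.\<close>

lemma value_of_orthogonal_unit:
  assumes t: "virtual_det a \<delta>" and orth: "\<And>g. g \<in> Gp \<Longrightarrow> a g * a (inv g) = 1" and g: "g \<in> Gp"
  obtains \<zeta> and e :: int where "\<zeta> \<in> mu (ord g)" "e = 1 \<or> e = -1" "a \<one> = of_int e"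
    "a g = of_int e * \<zeta>" "\<delta> g = red \<zeta> powi e"
proof -
  note gD = p_regularD[OF g]
  define u where "u = ord g"
  have u: "u > 0" using gD(2) by (simp add: u_def)
  note fin = card_mu(1)[OF u]
  obtain n where n: "\<And>j :: nat. a (g [^] j) = (\<Sum>\<zeta>\<in>mu u. of_int (n \<zeta>) * \<zeta> ^ j)"
    "\<delta> g = (\<Prod>\<zeta>\<in>mu u. red \<zeta> powi n \<zeta>)"
    using t g unfolding virtual_det_def u_def by blast
  have one: "1 = (\<Sum>\<zeta>\<in>mu u. \<Sum>\<xi>\<in>mu u. of_int (n \<zeta> * n \<xi>) * (\<zeta> * \<xi> ^ (u - 1)) ^ j)" for j
  proof -
    \<comment> \<open>As \<open>\<zeta>\<^sup>u = 1\<close>, the exponent \<open>u - 1\<close> stands for \<open>-1\<close>.\<close>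
    have "(u - 1) * j + j = u * j" using u by (cases u) simp_all
    then have "g [^] ((u - 1) * j) \<otimes> g [^] j = g [^] (u * j)"
      using gD(1) by (simp add: nat_pow_mult)
    also have "\<dots> = (g [^] u) [^] j"
      using gD(1) by (simp add: nat_pow_pow)
    also have "\<dots> = \<one>"
      using pow_ord_eq_1[OF gD(1)] by (simp add: u_def)
    finally have "inv (g [^] j) = g [^] ((u - 1) * j)"
      using gD(1) by (intro inv_equality) auto
    then have "1 = a (g [^] j) * a (g [^] ((u - 1) * j))"
      using orth[OF p_regular_pow[OF g, of j]] by simp
    also have "\<dots> = (\<Sum>\<zeta>\<in>mu u. \<Sum>\<xi>\<in>mu u. (of_int (n \<zeta>) * \<zeta> ^ j) * (of_int (n \<xi>) * \<xi> ^ ((u - 1) * j)))"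
      unfolding n(1) by (rule sum_product)
    finally show ?thesis
      unfolding power_mult power_mult_distrib of_int_mult by (simp only: mult_ac)
  qed
  have "of_nat u = (\<Sum>j<u. 1 :: 'k)" by simp
  also have "\<dots> = (\<Sum>j<u. \<Sum>\<zeta>\<in>mu u. \<Sum>\<xi>\<in>mu u. of_int (n \<zeta> * n \<xi>) * (\<zeta> * \<xi> ^ (u - 1)) ^ j)"
    by (intro sum.cong refl one)
  also have "\<dots> = (\<Sum>\<zeta>\<in>mu u. \<Sum>\<xi>\<in>mu u. \<Sum>j<u. of_int (n \<zeta> * n \<xi>) * (\<zeta> * \<xi> ^ (u - 1)) ^ j)"
    by (subst sum.swap, rule sum.cong[OF refl], rule sum.swap)
  also have "\<dots> = (\<Sum>\<zeta>\<in>mu u. \<Sum>\<xi>\<in>mu u. of_int (n \<zeta> * n \<xi>) * (if \<xi> = \<zeta> then of_nat u else 0))"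
  proof (intro sum.cong refl)
    fix \<zeta> \<xi> assume mu: "\<zeta> \<in> mu u" "\<xi> \<in> mu u"
    let ?w = "\<zeta> * \<xi> ^ (u - 1)"
    have "?w ^ u = 1"
      using mu by (simp add: mu_def power_mult_distrib) (metis mult.commute power_mult power_one)
    moreover have w: "?w * \<xi> = \<zeta>"
      using mu u by (simp add: mu_def mult.assoc flip: power_Suc2)
    have "?w = 1 \<longleftrightarrow> \<xi> = \<zeta>"
    proof
      assume "?w = 1"
      then show "\<xi> = \<zeta>" using w by simp
    next
      assume "\<xi> = \<zeta>"
      then show "?w = 1" using mu u by (simp add: mu_def flip: power_Suc)
    qed
    ultimately show "(\<Sum>j<u. of_int (n \<zeta> * n \<xi>) * ?w ^ j) =
        of_int (n \<zeta> * n \<xi>) * (if \<xi> = \<zeta> then of_nat u else 0)"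
      by (simp add: sum_powers_root_of_unity flip: sum_distrib_left)
  qed
  also have "\<dots> = (\<Sum>\<zeta>\<in>mu u. of_int (n \<zeta> * n \<zeta>) * of_nat u)"
    using fin by (simp add: if_distrib cong: if_cong)
  also have "\<dots> = of_nat u * of_int (\<Sum>\<zeta>\<in>mu u. n \<zeta> ^ 2)"
    by (simp add: sum_distrib_left power2_eq_square mult_ac)
  finally have sq: "of_int ((\<Sum>\<zeta>\<in>mu u. n \<zeta> ^ 2) - 1) = (0 :: 'k)"
    using of_nat_neq_0[OF u] by simp
  have "(\<Sum>\<zeta>\<in>mu u. n \<zeta> ^ 2) = 1"
    using of_int_neq_0[of "(\<Sum>\<zeta>\<in>mu u. n \<zeta> ^ 2) - 1"] sq by fastforce
  then obtain \<zeta> where z: "\<zeta> \<in> mu u" "n \<zeta> = 1 \<or> n \<zeta> = -1" and z': "\<And>\<xi>. \<xi> \<in> mu u \<Longrightarrow> \<xi> \<noteq> \<zeta> \<Longrightarrow> n \<xi> = 0"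
    using sum_squares_eq_one[OF fin] by metis
  have val: "a (g [^] j) = of_int (n \<zeta>) * \<zeta> ^ j" for j :: nat
  proof -
    have "a (g [^] j) = (\<Sum>\<xi>\<in>{\<zeta>}. of_int (n \<xi>) * \<xi> ^ j)"
      unfolding n(1) by (rule sum.mono_neutral_right[OF fin]) (use z z' in auto)
    then show ?thesis by simp
  qed
  have "\<delta> g = (\<Prod>\<xi>\<in>{\<zeta>}. red \<xi> powi n \<xi>)"
    unfolding n(2) by (rule prod.mono_neutral_right[OF fin]) (use z z' in auto)
  then show ?thesis
    using that[of \<zeta> "n \<zeta>"] z val[of 0] val[of 1] gD(1) by (simp add: u_def)
qed

text \<open>With \<open>m\<close> the largest divisor of the group order that is prime to \<open>p\<close>: values in the residue field of a
homomorphism on \<open>G\<close> are \<open>m\<close>-th roots of unity, also at elements that are not \<open>p\<close>-regular, and can be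
lifted.\<close>

lemma prime_to_p_exponent:
  obtains m where "m > 0" "coprime p m" "\<And>x :: 'f. x ^ Coset.order G = 1 \<Longrightarrow> x ^ m = 1"
proof -
  have "Coset.order G > 0" using fin order_gt_0_iff_finite by blast
  then obtain k m where m: "Coset.order G = m * p ^ k" "\<not> p dvd m"
    using prime_power_canonical[OF prime_p \<open>Coset.order G > 0\<close>] by blast
  show ?thesis
  proof (rule that)
    show "m > 0" using m \<open>Coset.order G > 0\<close> by (auto intro: Nat.gr0I)
    show "coprime p m" using m prime_p by (simp add: prime_imp_coprime)
    show "x ^ m = 1" if "x ^ Coset.order G = 1" for x :: 'f
      using that unfolding m(1) power_mult by (rule p_torsion_free)
  qed
qed

text \<open>The Teichmueller lift is multiplicative on roots of unity of a common order prime to \<open>p\<close>, and the values of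
\<open>\<delta>\<close> are such roots of unity.\<close>

lemma teich_hom_linear_char:
  assumes nz: "\<And>g. g \<in> carrier G \<Longrightarrow> \<delta> g \<noteq> 0"
    and mult: "\<And>g h. g \<in> carrier G \<Longrightarrow> h \<in> carrier G \<Longrightarrow> \<delta> (g \<otimes> h) = \<delta> g * \<delta> h"
  shows "(\<lambda>g. tch (\<delta> g)) \<in> linear_chars p \<iota> G"
proof -
  have "\<delta> \<one> * \<delta> \<one> = \<delta> \<one> * 1" using mult[of \<one> \<one>] by simp
  then have d1: "\<delta> \<one> = 1" using nz[of \<one>] by (simp only: mult_cancel_left) simp
  have pow: "\<delta> (g [^] j) = \<delta> g ^ j" if "g \<in> carrier G" for g and j :: nat
    using that by (induction j) (simp_all add: d1 mult)
  obtain m where m: "m > 0" "coprime p m" "\<And>x :: 'f. x ^ Coset.order G = 1 \<Longrightarrow> x ^ m = 1"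
    using prime_to_p_exponent by blast
  have root: "\<delta> g ^ m = 1" if "g \<in> carrier G" for g
    using pow[OF that, of "Coset.order G"] pow_order_eq_1[OF that] d1 by (intro m(3)) simp
  have unit: "x \<in> Units (integral_closure p \<iota>)" if "x \<in> \<O>" "x ^ m = 1" for x
    using that m(1) O.power[OF that(1), of "m - 1"]
    by (auto simp: Units_def integral_closure_simps(2,3) intro!: bexI[of _ "x ^ (m - 1)"]
        simp flip: power_Suc power_Suc2)
  show ?thesis
    unfolding linear_chars_def
  proof (rule homI)
    fix g assume "g \<in> carrier G"
    then show "tch (\<delta> g) \<in> carrier (units_of (integral_closure p \<iota>))"
      using unit teich_root[OF root m(1,2)] by (simp add: units_of_carrier)
  next
    fix g h assume "g \<in> carrier G" "h \<in> carrier G"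
    then show "tch (\<delta> (g \<otimes> h)) = tch (\<delta> g) \<otimes>\<^bsub>units_of (integral_closure p \<iota>)\<^esub> tch (\<delta> h)"
      using teich_mult[OF root root m(1,2)] by (simp add: units_of_mult integral_closure_simps mult)
  qed
qed

lemma orthogonal_unit_is_linear_char:
  assumes a: "a \<in> carrier RF" "\<And>g. g \<in> Gp \<Longrightarrow> a g * a (inv g) = 1" and a1: "a \<one> = 1"
  shows "\<exists>\<chi>\<in>linear_chars p \<iota> G. a = restrict \<chi> Gp"
proof -
  obtain \<delta> where t: "virtual_det a \<delta>" using ex_virtual_det[OF a(1)] by blast
  have val: "a g = tch (\<delta> g)" if g: "g \<in> Gp" for g
  proof -
    obtain \<zeta> and e :: int where z: "\<zeta> \<in> mu (ord g)" "e = 1 \<or> e = -1" "a \<one> = of_int e"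
      "a g = of_int e * \<zeta>" "\<delta> g = red \<zeta> powi e"
      using value_of_orthogonal_unit[OF t a(2) g] by metis
    \<comment> \<open>The sign is \<open>a(1) = 1\<close>, and \<open>1 \<noteq> -1\<close> in characteristic \<open>0\<close>.\<close>
    have "e \<noteq> -1"
    proof
      assume "e = -1"
      then have "(1 :: 'k) = -1" using z(3) a1 by simp
      then have "(1 + 1 :: 'k) = 0" by (simp only: eq_neg_iff_add_eq_0)
      then show False using of_nat_neq_0[of 2] by simp
    qed
    then have "e = 1" using z(2) by simp
    then show ?thesis
      using z teich_red[of \<zeta> "ord g"] p_regularD[OF g] by (simp add: mu_def)
  qed
  have "a = (\<lambda>g\<in>Gp. tch (\<delta> g))"
    using val brauer_ring_ext[OF a(1)] by (auto simp: restrict_def)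
  moreover have "(\<lambda>g. tch (\<delta> g)) \<in> linear_chars p \<iota> G"
    using t by (intro teich_hom_linear_char) (auto simp: virtual_det_def)
  ultimately show ?thesis by blast
qed

lemma linear_char_is_orthogonal_unit:
  assumes \<chi>: "\<chi> \<in> linear_chars p \<iota> G"
  shows "restrict \<chi> Gp \<in> carrier RF" "\<And>g. g \<in> Gp \<Longrightarrow> \<chi> g * \<chi> (inv g) = 1"
proof -
  have mult: "\<chi> (g \<otimes> h) = \<chi> g * \<chi> h" if "g \<in> carrier G" "h \<in> carrier G" for g h
    using \<chi> that by (simp add: linear_chars_def hom_def units_of_mult integral_closure_simps)
  have unit: "\<chi> g \<in> Units (integral_closure p \<iota>)" if "g \<in> carrier G" for g
    using \<chi> that by (auto simp: linear_chars_def hom_def units_of_carrier)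
  have O: "\<chi> g \<in> \<O>" and nz: "\<chi> g \<noteq> 0" if "g \<in> carrier G" for g
    using unit[OF that] by (auto simp: Units_def integral_closure_simps(2,3))
  have "\<chi> \<one> * \<chi> \<one> = \<chi> \<one> * 1" using mult[of \<one> \<one>] by simp
  then have d1: "\<chi> \<one> = 1" using nz[of \<one>] by (simp only: mult_cancel_left) simp
  have pow: "\<chi> (g [^] j) = \<chi> g ^ j" if "g \<in> carrier G" for g and j :: nat
    using that by (induction j) (simp_all add: d1 mult)
  show "\<chi> g * \<chi> (inv g) = 1" if "g \<in> Gp" for g
    using mult[of g "inv g"] p_regularD(1)[OF that] d1 by simp
  let ?\<rho> = "\<lambda>g. mat 1 1 (\<lambda>_. red (\<chi> g))"
  have rep: "mat_rep G 1 ?\<rho>"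
    unfolding mat_rep_def using O
    by (auto simp: mult d1 red_hom scalar_prod_def intro!: eq_matI)
  have "\<phi> ?\<rho> g = \<chi> g" if g: "g \<in> Gp" for g
  proof -
    note gD = p_regularD[OF g]
    have "\<phi> ?\<rho> g = (\<Sum>x\<in>#mset (diag_mat (?\<rho> g)). tch x)"
      by (rule brauer_char_eq[where n = 1 and \<rho> = ?\<rho>, OF g similar_mat_refl]) (auto simp: upper_triangular_def)
    also have "\<dots> = tch (red (\<chi> g))" by (simp add: diag_mat_def)
    also have "\<dots> = \<chi> g"
      using pow[OF gD(1), of "ord g"] pow_ord_eq_1[OF gD(1)] d1 gD(2,3)
      by (intro teich_red[of _ "ord g"]) auto
    finally show ?thesis .
  qed
  then have "restrict \<chi> Gp = \<phi> ?\<rho>"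
    by (auto simp: restrict_def brauer_char_def)
  then show "restrict \<chi> Gp \<in> carrier RF"
    using brauer_ring_brauer[OF rep] by (simp only:)
qed

theorem orthogonal_units_linear:
  "orthogonal_units p \<iota> red G =
         {restrict \<chi> Gp | \<chi>. \<chi> \<in> linear_chars p \<iota> G} \<union>
         {restrict (\<lambda>g. - \<chi> g) Gp | \<chi>. \<chi> \<in> linear_chars p \<iota> G}"
  unfolding orthogonal_units_eq
proof (intro equalityI subsetI)
  fix a assume "a \<in> {a \<in> carrier RF. \<forall>g\<in>Gp. a g * a (inv g) = 1}"
  then have a: "a \<in> carrier RF" "\<And>g. g \<in> Gp \<Longrightarrow> a g * a (inv g) = 1" by auto
  have "a \<one> = 1 \<or> a \<one> = -1"
    using a(2)[of \<one>] by (simp add: square_eq_1_iff)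
  then
  show "a \<in> {restrict \<chi> Gp | \<chi>. \<chi> \<in> linear_chars p \<iota> G} \<union>
         {restrict (\<lambda>g. - \<chi> g) Gp | \<chi>. \<chi> \<in> linear_chars p \<iota> G}"
  proof
    assume "a \<one> = 1"
    then show ?thesis using orthogonal_unit_is_linear_char[OF a] by blast
  next
    assume a1: "a \<one> = -1"
    define b where "b = (\<lambda>g\<in>Gp. - a g)"
    have "\<exists>\<chi>\<in>linear_chars p \<iota> G. b = restrict \<chi> Gp"
      using brauer_ring_uminus[OF a(1)] a a1 by (intro orthogonal_unit_is_linear_char) (auto simp: b_def)
    then obtain \<chi> where \<chi>: "\<chi> \<in> linear_chars p \<iota> G" "b = restrict \<chi> Gp" by blast
    have "a g = restrict (\<lambda>g. - \<chi> g) Gp g" for g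
      using brauer_ring_ext[OF a(1)] fun_cong[OF \<chi>(2), of g]
      by (cases "g \<in> Gp") (auto simp: b_def minus_equation_iff[of "a g"])
    then show ?thesis using \<chi>(1) by blast
  qed
next
  fix a assume "a \<in> {restrict \<chi> Gp | \<chi>. \<chi> \<in> linear_chars p \<iota> G} \<union>
         {restrict (\<lambda>g. - \<chi> g) Gp | \<chi>. \<chi> \<in> linear_chars p \<iota> G}"
  then obtain \<chi> where \<chi>: "\<chi> \<in> linear_chars p \<iota> G"
    and a: "a = restrict \<chi> Gp \<or> a = restrict (\<lambda>g. - \<chi> g) Gp" by blast
  have "restrict (\<lambda>g. - \<chi> g) Gp = (\<lambda>g\<in>Gp. - restrict \<chi> Gp g)"
    by (intro restrict_ext) simp
  then have "restrict (\<lambda>g. - \<chi> g) Gp \<in> carrier RF"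
    using brauer_ring_uminus[OF linear_char_is_orthogonal_unit(1)[OF \<chi>]] by (simp only:)
  then show "a \<in> {a \<in> carrier RF. \<forall>g\<in>Gp. a g * a (inv g) = 1}"
    using a linear_char_is_orthogonal_unit[OF \<chi>] by auto
qed

end

theorem theorem11p1:
  fixes G :: "'g monoid" and p :: nat
    and \<iota> :: "(nat \<Rightarrow> int) \<Rightarrow> 'k::alg_closed_field"
    and red :: "'k \<Rightarrow> 'f::field"
  assumes "group G" and "finite (carrier G)" and "prime p"
    and "padic_alg_closure p \<iota>" and "residue_map p \<iota> red"
  shows "orthogonal_units p \<iota> red G =
         {restrict \<chi> (p_regular p G) | \<chi>. \<chi> \<in> linear_chars p \<iota> G} \<union>
         {restrict (\<lambda>g. - \<chi> g) (p_regular p G) | \<chi>. \<chi> \<in> linear_chars p \<iota> G}"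
proof -
  interpret group G by fact
  interpret brauer_setup p \<iota> red G
    by unfold_locales (use assms in auto)
  show ?thesis by (rule orthogonal_units_linear)
qed

end
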